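(* For each $\hbar>0$ let $F=F_\hbar=S(L+X^{-1}R)(E_p+Y^{-1/2}O_p)$ be the operator on $L^2(\mathbb{R})$ described in the context. Then $F$ has a weak classical limit: for every function $A(x,p)=\sum_{a,b\in\mathbb{Z}}A_{ab}e^{2\pi i(ax+bp)}$ on the torus $\mathbb{T}^2$ and for almost every $(x_0,p_0)\in\mathbb{R}^2$, $$\lim_{\hbar\to0}\Big(\langle \phi_\hbar;x_0,p_0|\,F^\dagger Q_\hbar(A)F\,|\phi_\hbar;x_0,p_0\rangle-\langle \phi_\hbar;\beta(x_0,p_0)|\,Q_\hbar(A)\,|\phi_\hbar;\beta(x_0,p_0)\rangle\Big)=0 .$$
   Context: $\widehat x$ is multiplication by $x$ and $\widehat p=(\hbar/i)d/dx$ on $L^2(\mathbb{R})$; $U=e^{2\pi i\widehat x}$, $V=e^{2\pi i\widehat p}$; $Q_\hbar(A)=\sum_{a,b}A_{ab}U^aV^b$. For real $s$, $X^{s}=e^{is\widehat{x}/\hbar}$, $Y^{s}=e^{is\widehat{p}/\hbar}$. $S=\exp\!\big(-\tfrac{i\log 2}{2\hbar}(\widehat{x}\widehat{p}+\widehat{p}\widehat{x})\big)$. $L$, $R$ are multiplication by the indicators of $[0,1/2)+\mathbb{Z}$ and $[1/2,1)+\mathbb{Z}$; $E_p$, $O_p$ are the spectral projections of $\widehat p$ onto $[0,1)+2\mathbb{Z}$ and $[1,2)+2\mathbb{Z}$. The coherent state $|\phi_\hbar;x_0,p_0\rangle$ has wave function $\phi(x)=(\pi\hbar)^{-1/4}e^{-(x-x_0)^2/2\hbar}e^{ip_0x/\hbar-ip_0x_0/2\hbar}$.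 The classical map $\beta:\mathbb{R}^2\to\mathbb{R}^2$ (baker covering map) is: $\beta(x,p)=(2x,p/2)$ if $x\in[0,1/2)+\mathbb{Z}$, $p\in[0,1)+2\mathbb{Z}$; $(2x-1,p/2+1/2)$ if $x\in[1/2,1)+\mathbb{Z}$, $p\in[0,1)+2\mathbb{Z}$; $(2x+1,p/2+1/2)$ if $x\in[0,1/2)+\mathbb{Z}$, $p\in[1,2)+2\mathbb{Z}$; $(2x,p/2)$ if $x\in[1/2,1)+\mathbb{Z}$, $p\in[1,2)+2\mathbb{Z}$. *)

theory Defs
  imports "HOL-Analysis.Analysis"
begin

type_synonym wavefn = "real \<Rightarrow> complex"

text \<open>X^s = exp(i s xhat / hbar): multiplication by exp(i s x / hbar).\<close>
definition X_op :: "real \<Rightarrow> real \<Rightarrow> wavefn \<Rightarrow> wavefn" where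
  "X_op hbar s \<psi> = (\<lambda>x. exp (\<i> * complex_of_real (s * x / hbar)) * \<psi> x)"

text \<open>Y^s = exp(i s phat / hbar) = exp(s d/dx): translation, (Y^s psi)(x) = psi(x+s).\<close>
definition Y_op :: "real \<Rightarrow> wavefn \<Rightarrow> wavefn" where
  "Y_op s \<psi> = (\<lambda>x. \<psi> (x + s))"

text \<open>S = exp(-(i log 2/(2 hbar))(xp+px)) = exp(-log 2 (x d/dx + 1/2)):
  (S psi)(x) = 2^(-1/2) psi(x/2).\<close>
definition S_op :: "wavefn \<Rightarrow> wavefn" where
  "S_op \<psi> = (\<lambda>x. complex_of_real (1 / sqrt 2) * \<psi> (x / 2))"

definition L_op :: "wavefn \<Rightarrow> wavefn" where
  "L_op \<psi> = (\<lambda>x. indicator {x. frac x < 1/2} x * \<psi> x)"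

definition R_op :: "wavefn \<Rightarrow> wavefn" where
  "R_op \<psi> = (\<lambda>x. indicator {x. 1/2 \<le> frac x} x * \<psi> x)"

text \<open>Spectral projection of phat = (hbar/i) d/dx onto a set B, via the Fourier
  transform (eigenfunctions exp(i p x/hbar)):
  (P_B psi)(x) = (2 pi hbar)^(-1) int_B exp(i p x/hbar) (int exp(-i p y/hbar) psi(y) dy) dp.
  (This integral formula is the spectral projection for psi in L1 with integrable
  Fourier transform, which covers the coherent states it is applied to.)\<close>
definition spec_proj_p :: "real \<Rightarrow> real set \<Rightarrow> wavefn \<Rightarrow> wavefn" where
  "spec_proj_p hbar B \<psi> = (\<lambda>x. complex_of_real (1 / (2 * pi * hbar)) *
      (LINT p|lborel. indicator B p * exp (\<i> * complex_of_real (p * x / hbar)) *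
          (LINT y|lborel. exp (- \<i> * complex_of_real (p * y / hbar)) * \<psi> y)))"

definition E_p :: "real \<Rightarrow> wavefn \<Rightarrow> wavefn" where
  "E_p hbar = spec_proj_p hbar {p. frac (p / 2) < 1/2}"

definition O_p :: "real \<Rightarrow> wavefn \<Rightarrow> wavefn" where
  "O_p hbar = spec_proj_p hbar {p. 1/2 \<le> frac (p / 2)}"

definition F_op :: "real \<Rightarrow> wavefn \<Rightarrow> wavefn" where
  "F_op hbar \<psi> =
     (let G = (\<lambda>x. E_p hbar \<psi> x + Y_op (-1/2) (O_p hbar \<psi>) x)
      in S_op (\<lambda>x. L_op G x + X_op hbar (-1) (R_op G) x))"

text \<open>Weyl quantization Q_hbar(A) = sum_{a,b} A_ab U^a V^b with U = exp(2 pi i xhat)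
  (multiplication by exp(2 pi i x)) and V = exp(2 pi i phat) (translation by 2 pi hbar).\<close>
definition Q_op :: "real \<Rightarrow> (int \<times> int \<Rightarrow> complex) \<Rightarrow> wavefn \<Rightarrow> wavefn" where
  "Q_op hbar A \<psi> = (\<lambda>x. infsum (\<lambda>(a, b). A (a, b) *
       exp (2 * pi * \<i> * complex_of_real (real_of_int a * x)) *
       \<psi> (x + 2 * pi * hbar * real_of_int b)) UNIV)"

definition expval :: "wavefn \<Rightarrow> wavefn \<Rightarrow> complex" where
  "expval \<psi> T\<psi> = (LINT x|lborel. cnj (\<psi> x) * T\<psi> x)"

definition coh :: "real \<Rightarrow> real \<Rightarrow> real \<Rightarrow> wavefn" where
  "coh hbar x0 p0 = (\<lambda>x. complex_of_real ((pi * hbar) powr (-1/4) * exp (- ((x - x0)^2) / (2 * hbar))) *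
      exp (\<i> * complex_of_real (p0 * x / hbar - p0 * x0 / (2 * hbar))))"

definition baker :: "real \<times> real \<Rightarrow> real \<times> real" where
  "baker z = (let x = fst z; p = snd z in
     if frac x < 1/2 \<and> frac (p/2) < 1/2 then (2*x, p/2)
     else if 1/2 \<le> frac x \<and> frac (p/2) < 1/2 then (2*x - 1, p/2 + 1/2)
     else if frac x < 1/2 \<and> 1/2 \<le> frac (p/2) then (2*x + 1, p/2 + 1/2)
     else (2*x, p/2))"

end

theory Submission
  imports Defs "HOL-Probability.Probability" "HOL-Real_Asymp.Real_Asymp"
begin

text \<open>
  A coherent state whose centre lies off the discontinuity lines is, up to an error that is
  exponentially small in L2 as hbar tends to 0, an eigenvector of each of the projections E, O, L, R.
  Hence F maps it to a squeezed and displaced coherent state S X^k Y^s phi up to such an error.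
  On the momentum side the error is the spectral projection of phi to the region that avoids the
  centre; its L2 norm is controlled by the Plancherel inequality applied to the explicit Gaussian
  Fourier transform of phi. The matrix elements of U^a V^b in the displaced state are Gaussian
  integrals that converge to exp (2 pi i (a x + b p)) at a point (x, p) equal to the baker image
  modulo the integer lattice, and so do those in the coherent state at the baker image itself.
  Since the coefficients A are absolutely summable, Tannery's theorem gives both expectation values
  the same limit.
\<close>

section \<open>Gaussian integrals and square-integrable functions\<close>

text \<open>Operators are formulas acting on functions, so norm facts are proved directly for the
  functions that occur. Two kinds of control are needed: the series in \<open>Q_op\<close> is
  pointwise, which calls for a sup bound on the wave function at each fixed hbar, while the
  comparison of expectation values calls for L2 bounds uniform in hbar. L2 errors suffice because
  U^a V^b preserves the L2 norm, so one estimate serves all \<open>a\<close> and \<open>b\<close>.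
  The obstacle is the sharp momentum cutoff, whose effect on a Gaussian has no elementary closed
  form. Only the small projection is therefore estimated, and an inequality in Plancherel is enough
  for that; the large one is the state minus the small one, by Fourier inversion for Gaussians. The
  squeezed state may replace a coherent one because U^a V^b multiplies by a fixed frequency and
  translates by O(hbar): both Gaussians have width of order sqrt hbar, and only their centre
  survives in the limit.\<close>

lemma has_bochner_integral_gaussian_fourier_std:
  "has_bochner_integral lborel
     (\<lambda>x. complex_of_real (exp (- x\<^sup>2 / 2)) * exp (\<i> * complex_of_real (t * x)))
     (complex_of_real (sqrt (2 * pi) * exp (- t\<^sup>2 / 2)))"
proof -
  let ?f = "\<lambda>x. complex_of_real (std_normal_density x) * exp (\<i> * complex_of_real (t * x))"
  have int: "integrable lborel ?f"
    by (rule Bochner_Integration.integrable_bound[OF integrable_normal_density[where \<mu> = 0 and \<sigma> = 1]])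
       (auto simp: norm_mult)
  have "(LINT x|lborel. ?f x) = char std_normal_distribution t"
    unfolding char_def
    by (subst integral_density) (auto simp: scaleR_conv_of_real)
  then have "(LINT x|lborel. ?f x) = complex_of_real (exp (- t\<^sup>2 / 2))"
    by (simp add: char_std_normal_distribution)
  with int have "has_bochner_integral lborel ?f (complex_of_real (exp (- t\<^sup>2 / 2)))"
    by (simp add: has_bochner_integral_iff)
  from has_bochner_integral_mult_right[where c = "complex_of_real (sqrt (2 * pi))", OF this]
  show ?thesis
    by (simp add: std_normal_density_def field_simps)
qed

text \<open>The substitution x = m + sqrt v * y reduces this to the standard normal case. All
  explicit integrals below are instances: overlaps, the Fourier transform of a coherent state and
  its inverse, and the kernel in the Plancherel bound.\<close>

lemma has_bochner_integral_gaussian_fourier: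
  fixes v m c :: real
  assumes v: "v > 0"
  shows "has_bochner_integral lborel
     (\<lambda>x. complex_of_real (exp (- (x - m)\<^sup>2 / (2 * v))) * exp (\<i> * complex_of_real (c * x)))
     (complex_of_real (sqrt (2 * pi * v) * exp (- (c\<^sup>2 * v / 2))) * exp (\<i> * complex_of_real (c * m)))"
    (is "has_bochner_integral _ ?f ?I")
proof -
  define s where "s = sqrt v"
  have s: "s > 0" "s\<^sup>2 = v" using v by (auto simp: s_def)
  have eq: "?f (m + s * y) = exp (\<i> * complex_of_real (c * m)) *
      (complex_of_real (exp (- y\<^sup>2 / 2)) * exp (\<i> * complex_of_real ((c * s) * y)))" for y
  proof -
    have "(m + s * y - m)\<^sup>2 / (2 * v) = y\<^sup>2 / 2"
      using v by (simp add: power_mult_distrib s)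
    then have "exp (- (m + s * y - m)\<^sup>2 / (2 * v)) = exp (- y\<^sup>2 / 2)" by simp
    moreover have "exp (\<i> * complex_of_real (c * (m + s * y))) =
        exp (\<i> * complex_of_real (c * m)) * exp (\<i> * complex_of_real ((c * s) * y))"
      by (simp add: exp_add[symmetric] algebra_simps)
    ultimately show ?thesis by (simp only: mult_ac)
  qed
  have "has_bochner_integral lborel (\<lambda>y. ?f (m + s * y))
      (exp (\<i> * complex_of_real (c * m)) * (complex_of_real (sqrt (2 * pi) * exp (- (c * s)\<^sup>2 / 2))))"
    unfolding eq
    by (intro has_bochner_integral_mult_right has_bochner_integral_gaussian_fourier_std)
  moreover have "exp (\<i> * complex_of_real (c * m)) * (complex_of_real (sqrt (2 * pi) * exp (- (c * s)\<^sup>2 / 2)))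
      = ?I /\<^sub>R \<bar>s\<bar>"
    using s by (simp add: scaleR_conv_of_real power_mult_distrib real_sqrt_mult s_def)
  ultimately show ?thesis
    using lborel_has_bochner_integral_real_affine_iff[of s ?f ?I m] s by simp
qed

lemma has_bochner_integral_gaussian:
  fixes v m :: real
  assumes v: "v > 0"
  shows "has_bochner_integral lborel (\<lambda>x. exp (- (x - m)\<^sup>2 / (2 * v))) (sqrt (2 * pi * v))"
  using has_bochner_integral_gaussian_fourier[OF v, of m 0]
    integrable_Re[of lborel "\<lambda>x. complex_of_real (exp (- (x - m)\<^sup>2 / (2 * v)))"]
  by (simp add: has_bochner_integral_iff)

lemma borel_measurable_cnj [measurable]: "cnj \<in> borel_measurable borel"
  by (intro borel_measurable_continuous_onI continuous_intros)

text \<open>Wave functions are genuine functions rather than classes modulo null sets, so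
  measurability is carried along. Since a divergent integral has the default value 0, a bound on
  \<open>norm_sq\<close> is informative only together with \<open>sq_integrable\<close>; the two are
  therefore proved in pairs.\<close>

definition sq_integrable :: "wavefn \<Rightarrow> bool" where
  "sq_integrable f \<longleftrightarrow> f \<in> borel_measurable borel \<and> integrable lborel (\<lambda>x. (cmod (f x))\<^sup>2)"

definition norm_sq :: "wavefn \<Rightarrow> real" where
  "norm_sq f = (LINT x|lborel. (cmod (f x))\<^sup>2)"

lemma norm_sq_nonneg [simp]: "0 \<le> norm_sq f"
  by (simp add: norm_sq_def)

lemma sq_integrable_measurable [measurable_dest]: "sq_integrable f \<Longrightarrow> f \<in> borel_measurable borel"
  by (simp add: sq_integrable_def)

lemma norm_sq_mono:
  assumes "sq_integrable g" "f \<in> borel_measurable borel" "\<And>x. cmod (f x) \<le> cmod (g x)"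
  shows "sq_integrable f" "norm_sq f \<le> norm_sq g"
proof -
  have le: "(cmod (f x))\<^sup>2 \<le> (cmod (g x))\<^sup>2" for x
    using assms(3)[of x] by (simp add: power_mono)
  have m[measurable]: "f \<in> borel_measurable borel" by fact
  have "integrable lborel (\<lambda>x. (cmod (f x))\<^sup>2)"
    by (rule Bochner_Integration.integrable_bound[where f = "\<lambda>x. (cmod (g x))\<^sup>2"])
       (use assms le in \<open>auto simp: sq_integrable_def\<close>)
  then show "sq_integrable f" using m by (simp add: sq_integrable_def)
  then show "norm_sq f \<le> norm_sq g"
    using assms(1) le unfolding norm_sq_def sq_integrable_def by (intro integral_mono) auto
qed

text \<open>From 2|f||g| <= |f|^2 + |g|^2. This form of the triangle inequality avoids square roots;
  the lost factor 2 is harmless against exponentially small errors.\<close>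

lemma norm_sq_add:
  assumes "sq_integrable f" "sq_integrable g"
  shows "sq_integrable (\<lambda>x. f x + g x)" "norm_sq (\<lambda>x. f x + g x) \<le> 2 * norm_sq f + 2 * norm_sq g"
proof -
  have le: "(cmod (f x + g x))\<^sup>2 \<le> 2 * (cmod (f x))\<^sup>2 + 2 * (cmod (g x))\<^sup>2" for x
  proof -
    have "(cmod (f x + g x))\<^sup>2 \<le> (cmod (f x) + cmod (g x))\<^sup>2"
      by (intro power_mono norm_triangle_ineq) auto
    also have "\<dots> \<le> 2 * (cmod (f x))\<^sup>2 + 2 * (cmod (g x))\<^sup>2"
      by (rule order_trans[OF _ order.refl]) (use sum_squares_bound[of "cmod (f x)" "cmod (g x)"] in \<open>simp add: power2_sum\<close>)
    finally show ?thesis .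
  qed
  have int: "integrable lborel (\<lambda>x. 2 * (cmod (f x))\<^sup>2 + 2 * (cmod (g x))\<^sup>2)"
    using assms by (auto simp: sq_integrable_def)
  note [measurable] = assms[THEN sq_integrable_measurable]
  have i2: "integrable lborel (\<lambda>x. (cmod (f x + g x))\<^sup>2)"
    by (rule Bochner_Integration.integrable_bound[OF int]) (use le in auto)
  show "sq_integrable (\<lambda>x. f x + g x)" using i2 by (simp add: sq_integrable_def)
  have "norm_sq (\<lambda>x. f x + g x) \<le> (LINT x|lborel. 2 * (cmod (f x))\<^sup>2 + 2 * (cmod (g x))\<^sup>2)"
    unfolding norm_sq_def using int i2 le by (intro integral_mono) auto
  also have "\<dots> = 2 * norm_sq f + 2 * norm_sq g"
    using assms by (simp add: norm_sq_def sq_integrable_def)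
  finally show "norm_sq (\<lambda>x. f x + g x) \<le> 2 * norm_sq f + 2 * norm_sq g" .
qed

lemma norm_sq_cmult:
  assumes "sq_integrable f"
  shows "sq_integrable (\<lambda>x. c * f x)" "norm_sq (\<lambda>x. c * f x) = (cmod c)\<^sup>2 * norm_sq f"
  using assms by (auto simp: sq_integrable_def norm_sq_def norm_mult power_mult_distrib)

lemma norm_sq_affine:
  assumes "sq_integrable f" "c \<noteq> 0"
  shows "sq_integrable (\<lambda>x. f (t + c * x))" "norm_sq (\<lambda>x. f (t + c * x)) = norm_sq f / \<bar>c\<bar>"
proof -
  note [measurable] = assms(1)[THEN sq_integrable_measurable]
  show "sq_integrable (\<lambda>x. f (t + c * x))"
    using assms lborel_integrable_real_affine[of "\<lambda>x. (cmod (f x))\<^sup>2" c t]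
    by (simp add: sq_integrable_def)
  show "norm_sq (\<lambda>x. f (t + c * x)) = norm_sq f / \<bar>c\<bar>"
    using lborel_integral_real_affine[OF assms(2), of "\<lambda>x. (cmod (f x))\<^sup>2" t] assms(2)
    by (simp add: norm_sq_def)
qed

text \<open>The inequality is taken for extended nonnegative integrals and carried back to the
  reals, so integrability of the product, from |f g| <= |f|^2 + |g|^2, comes before it. The bound on
  the integral of the modulus is what the exchange of sum and integral in \<open>expval_Q_op\<close>
  requires.\<close>

lemma expval_Cauchy_Schwarz:
  assumes "sq_integrable f" "sq_integrable g"
  shows "integrable lborel (\<lambda>x. cnj (f x) * g x)"
    and "(LINT x|lborel. cmod (cnj (f x) * g x)) \<le> sqrt (norm_sq f) * sqrt (norm_sq g)"
    and "cmod (expval f g) \<le> sqrt (norm_sq f) * sqrt (norm_sq g)"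
proof -
  note [measurable] = assms[THEN sq_integrable_measurable]
  have int: "integrable lborel (\<lambda>x. (cmod (f x))\<^sup>2 + (cmod (g x))\<^sup>2)"
    using assms by (auto simp: sq_integrable_def)
  show i: "integrable lborel (\<lambda>x. cnj (f x) * g x)"
  proof (rule Bochner_Integration.integrable_bound[OF int])
    show "AE x in lborel. norm (cnj (f x) * g x) \<le> norm ((cmod (f x))\<^sup>2 + (cmod (g x))\<^sup>2)"
    proof (rule AE_I2)
      fix x
      have "0 \<le> cmod (f x) * cmod (g x)" by simp
      then show "norm (cnj (f x) * g x) \<le> norm ((cmod (f x))\<^sup>2 + (cmod (g x))\<^sup>2)"
        using sum_squares_bound[of "cmod (f x)" "cmod (g x)"]
        unfolding norm_mult complex_mod_cnj real_norm_def by linarith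
    qed
  qed simp
  have "(\<integral>\<^sup>+x. ennreal (cmod (f x)) * ennreal (cmod (g x)) \<partial>lborel)\<^sup>2 \<le>
        (\<integral>\<^sup>+x. (ennreal (cmod (f x)))\<^sup>2 \<partial>lborel) * (\<integral>\<^sup>+x. (ennreal (cmod (g x)))\<^sup>2 \<partial>lborel)"
    by (rule Cauchy_Schwarz_nn_integral) auto
  moreover have "(\<integral>\<^sup>+x. (ennreal (cmod (h x)))\<^sup>2 \<partial>lborel) = ennreal (norm_sq h)" if "sq_integrable h" for h
    unfolding norm_sq_def using that
    by (subst nn_integral_eq_integral[symmetric]) (auto simp: sq_integrable_def ennreal_power)
  moreover have "(\<integral>\<^sup>+x. ennreal (cmod (f x)) * ennreal (cmod (g x)) \<partial>lborel) = ennreal (LINT x|lborel. cmod (cnj (f x) * g x))"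
    using integrable_norm[OF i]
    by (subst nn_integral_eq_integral[symmetric]) (simp_all add: norm_mult ennreal_mult)
  ultimately have "ennreal ((LINT x|lborel. cmod (cnj (f x) * g x))\<^sup>2) \<le> ennreal (norm_sq f * norm_sq g)"
    using assms by (simp add: ennreal_power ennreal_mult)
  then have "(LINT x|lborel. cmod (cnj (f x) * g x))\<^sup>2 \<le> norm_sq f * norm_sq g"
    by simp
  then show le: "(LINT x|lborel. cmod (cnj (f x) * g x)) \<le> sqrt (norm_sq f) * sqrt (norm_sq g)"
    by (metis real_le_rsqrt real_sqrt_mult)
  show "cmod (expval f g) \<le> sqrt (norm_sq f) * sqrt (norm_sq g)"
    unfolding expval_def by (rule order_trans[OF integral_norm_bound le])
qed

section \<open>Weyl operators and torus observables\<close>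

text \<open>The unitary U^a V^b, so that \<open>Q_op\<close> is the sum of these weighted by
  \<open>A\<close>.\<close>

definition weyl :: "real \<Rightarrow> int \<Rightarrow> int \<Rightarrow> wavefn \<Rightarrow> wavefn" where
  "weyl hbar a b \<psi> = (\<lambda>x. exp (2 * pi * \<i> * complex_of_real (real_of_int a * x)) *
       \<psi> (x + 2 * pi * hbar * real_of_int b))"

lemma cmod_weyl: "cmod (weyl hbar a b \<psi> x) = cmod (\<psi> (x + 2 * pi * hbar * real_of_int b))"
  by (simp add: weyl_def norm_mult)

lemma norm_sq_weyl:
  assumes "sq_integrable \<psi>"
  shows "sq_integrable (weyl hbar a b \<psi>)" "norm_sq (weyl hbar a b \<psi>) = norm_sq \<psi>"
proof -
  note [measurable] = sq_integrable_measurable[OF assms]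
  have [measurable]: "weyl hbar a b \<psi> \<in> borel_measurable borel"
    unfolding weyl_def by measurable
  note * = norm_sq_affine[OF assms, of 1 "2 * pi * hbar * real_of_int b"]
  show "sq_integrable (weyl hbar a b \<psi>)" "norm_sq (weyl hbar a b \<psi>) = norm_sq \<psi>"
    using * by (auto simp: sq_integrable_def norm_sq_def cmod_weyl add.commute)
qed

lemma cmod_expval_weyl_le:
  assumes "sq_integrable \<psi>"
  shows "cmod (expval \<psi> (weyl hbar a b \<psi>)) \<le> norm_sq \<psi>"
    "integrable lborel (\<lambda>x. cnj (\<psi> x) * weyl hbar a b \<psi> x)"
    "(LINT x|lborel. cmod (cnj (\<psi> x) * weyl hbar a b \<psi> x)) \<le> norm_sq \<psi>"
  using expval_Cauchy_Schwarz[OF assms norm_sq_weyl(1)[OF assms, of hbar a b]] norm_sq_weyl(2)[OF assms]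
  by auto

text \<open>With g = f + r and W = U^a V^b, the difference of the quadratic forms is <r, W g> + <f,
  W r>. Each term contains one factor r, and W is isometric, so the bound does not depend on
  \<open>a\<close> and \<open>b\<close>.\<close>

lemma expval_weyl_perturb:
  assumes f: "sq_integrable f" and r: "sq_integrable r"
  shows "cmod (expval (\<lambda>x. f x + r x) (weyl hbar a b (\<lambda>x. f x + r x)) - expval f (weyl hbar a b f))
           \<le> sqrt (norm_sq r) * (sqrt (norm_sq (\<lambda>x. f x + r x)) + sqrt (norm_sq f))"
proof -
  let ?g = "\<lambda>x. f x + r x"
  have g: "sq_integrable ?g" using norm_sq_add f r by blast
  note I = expval_Cauchy_Schwarz(1)[OF _ norm_sq_weyl(1)]
  have eq: "cnj (?g x) * weyl hbar a b ?g x - cnj (f x) * weyl hbar a b f x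
     = cnj (r x) * weyl hbar a b ?g x + cnj (f x) * weyl hbar a b r x" for x
    by (simp add: weyl_def algebra_simps)
  have "expval ?g (weyl hbar a b ?g) - expval f (weyl hbar a b f)
      = (LINT x|lborel. cnj (?g x) * weyl hbar a b ?g x - cnj (f x) * weyl hbar a b f x)"
    unfolding expval_def by (rule Bochner_Integration.integral_diff[symmetric]) (intro I f g)+
  also have "\<dots> = expval r (weyl hbar a b ?g) + expval f (weyl hbar a b r)"
    unfolding eq expval_def by (rule Bochner_Integration.integral_add) (intro I f g r)+
  finally have "cmod (expval ?g (weyl hbar a b ?g) - expval f (weyl hbar a b f))
      \<le> cmod (expval r (weyl hbar a b ?g)) + cmod (expval f (weyl hbar a b r))"
    by (metis norm_triangle_ineq)
  also have "\<dots> \<le> sqrt (norm_sq r) * sqrt (norm_sq ?g) + sqrt (norm_sq f) * sqrt (norm_sq r)"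
    using expval_Cauchy_Schwarz(3)[OF r norm_sq_weyl(1)[OF g]]
      expval_Cauchy_Schwarz(3)[OF f norm_sq_weyl(1)[OF r]]
      norm_sq_weyl(2)[OF g] norm_sq_weyl(2)[OF r] by (metis add_mono)
  finally show ?thesis by (simp add: algebra_simps)
qed

text \<open>The sup bound \<open>B\<close> makes the series defining \<open>Q_op\<close> absolutely
  convergent at every point, so its \<open>infsum\<close> is a true sum and not a default value. The
  exchange with the integral rests instead on the L2 bound for each term. The enumeration
  \<open>e\<close> turns the family over pairs of integers into a sequence.\<close>

lemma expval_Q_op:
  fixes e :: "nat \<Rightarrow> int \<times> int"
  assumes \<psi>: "sq_integrable \<psi>" and bdd: "\<And>x. cmod (\<psi> x) \<le> B"
    and e: "bij e" and A: "summable (\<lambda>n. norm (A (e n)))"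
  shows "expval \<psi> (Q_op hbar A \<psi>) = (\<Sum>n. A (e n) * expval \<psi> (weyl hbar (fst (e n)) (snd (e n)) \<psi>))"
proof -
  let ?w = "\<lambda>n. weyl hbar (fst (e n)) (snd (e n)) \<psi>"
  note I = cmod_expval_weyl_le[OF \<psi>, of hbar]
  have B0: "0 \<le> B" using bdd[of 0] norm_ge_zero order_trans by blast
  have sm: "summable (\<lambda>n. norm (A (e n) * ?w n x))" for x
  proof (rule summable_comparison_test'[where N = 0])
    show "summable (\<lambda>n. norm (A (e n)) * B)" using A by (rule summable_mult2)
    show "norm (norm (A (e n) * ?w n x)) \<le> norm (A (e n)) * B" for n
      by (auto simp: norm_mult cmod_weyl intro!: mult_left_mono bdd)
  qed
  have Q: "Q_op hbar A \<psi> x = (\<Sum>n. A (e n) * ?w n x)" for x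
  proof -
    have "Q_op hbar A \<psi> x = infsum (\<lambda>ab. A ab * weyl hbar (fst ab) (snd ab) \<psi> x) UNIV"
      unfolding Q_op_def weyl_def by (intro infsum_cong) (auto simp: mult.assoc)
    also have "\<dots> = infsum (\<lambda>n. A (e n) * ?w n x) UNIV"
      using infsum_reindex_bij_betw[OF e, of "\<lambda>ab. A ab * weyl hbar (fst ab) (snd ab) \<psi> x"] by simp
    also have "\<dots> = (\<Sum>n. A (e n) * ?w n x)"
      using norm_summable_imp_has_sum[OF sm summable_sums[OF summable_norm_cancel[OF sm]]]
      by (rule infsumI)
    finally show ?thesis .
  qed
  have "expval \<psi> (Q_op hbar A \<psi>) = (LINT x|lborel. (\<Sum>n. A (e n) * (cnj (\<psi> x) * ?w n x)))"
    unfolding expval_def Q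
    by (simp add: suminf_mult[OF summable_norm_cancel[OF sm], symmetric] mult.left_commute)
  also have "\<dots> = (\<Sum>n. LINT x|lborel. A (e n) * (cnj (\<psi> x) * ?w n x))"
  proof (rule integral_suminf)
    show "integrable lborel (\<lambda>x. A (e n) * (cnj (\<psi> x) * ?w n x))" for n
      using I(2) by (intro integrable_mult_right) simp
    show "AE x in lborel. summable (\<lambda>n. norm (A (e n) * (cnj (\<psi> x) * ?w n x)))"
    proof (rule AE_I2)
      fix x
      show "summable (\<lambda>n. norm (A (e n) * (cnj (\<psi> x) * ?w n x)))"
        using summable_mult[OF sm, of "cmod (\<psi> x)"] by (simp add: norm_mult mult_ac)
    qed
    show "summable (\<lambda>n. LINT x|lborel. norm (A (e n) * (cnj (\<psi> x) * ?w n x)))"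
    proof (rule summable_comparison_test'[where N = 0])
      show "summable (\<lambda>n. norm (A (e n)) * norm_sq \<psi>)" using A by (rule summable_mult2)
      show "norm (LINT x|lborel. norm (A (e n) * (cnj (\<psi> x) * ?w n x))) \<le> norm (A (e n)) * norm_sq \<psi>" for n
        using I(3)[of "fst (e n)" "snd (e n)"]
        by (auto simp: norm_mult[of "A _"] intro!: mult_left_mono)
    qed
  qed
  also have "\<dots> = (\<Sum>n. A (e n) * expval \<psi> (?w n))"
    by (simp add: expval_def)
  finally show ?thesis .
qed

lemma tendsto_expval_Q_op:
  fixes \<psi> :: "real \<Rightarrow> wavefn" and w :: "int \<Rightarrow> int \<Rightarrow> complex"
  assumes \<psi>: "\<And>h. h > 0 \<Longrightarrow> sq_integrable (\<psi> h)"
    and bdd: "\<And>h. h > 0 \<Longrightarrow> \<exists>B. \<forall>x. cmod (\<psi> h x) \<le> B"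
    and C: "eventually (\<lambda>h. norm_sq (\<psi> h) \<le> C) (at_right 0)"
    and lim: "\<And>a b. ((\<lambda>h. expval (\<psi> h) (weyl h a b (\<psi> h))) \<longlongrightarrow> w a b) (at_right 0)"
    and e: "bij e" and A: "summable (\<lambda>n. norm (A (e n)))"
  shows "((\<lambda>h. expval (\<psi> h) (Q_op h A (\<psi> h))) \<longlongrightarrow> (\<Sum>n. A (e n) * w (fst (e n)) (snd (e n)))) (at_right 0)"
proof -
  let ?m = "\<lambda>n h. A (e n) * expval (\<psi> h) (weyl h (fst (e n)) (snd (e n)) (\<psi> h))"
  have "((\<lambda>h. \<Sum>n. ?m n h) \<longlongrightarrow> (\<Sum>n. A (e n) * w (fst (e n)) (snd (e n)))) (at_right 0)"
  proof (rule tannerys_theorem[THEN conjunct2, THEN conjunct2])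
    show "((\<lambda>h. ?m n h) \<longlongrightarrow> A (e n) * w (fst (e n)) (snd (e n))) (at_right 0)" for n
      by (intro tendsto_intros lim)
    show "summable (\<lambda>n. norm (A (e n)) * C)" using A by (rule summable_mult2)
    have "eventually (\<lambda>h. h > (0::real) \<and> norm_sq (\<psi> h) \<le> C) (at_right 0)"
      using C eventually_at_right_less[of "0::real"] by eventually_elim auto
    then have "eventually (\<lambda>h. \<forall>n. norm (?m n h) \<le> norm (A (e n)) * C) (at_right 0)"
    proof eventually_elim
      case (elim h)
      show ?case
        using elim cmod_expval_weyl_le(1)[OF \<psi>, of h]
        by (auto simp: norm_mult intro!: mult_left_mono intro: order_trans)
    qed
    \<comment> \<open>Tannery's theorem asks for domination along the product filter; the bound
      holds for all \<open>n\<close> at once, so only the \<open>h\<close> component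
      matters.\<close>
    then have "eventually (\<lambda>nh. \<forall>n. norm (?m n (snd nh)) \<le> norm (A (e n)) * C) (at_top \<times>\<^sub>F at_right (0::real))"
      by (rule eventually_compose_filterlim[OF _ filterlim_snd])
    then show "eventually (\<lambda>(n, h). norm (?m n h) \<le> norm (A (e n)) * C) (at_top \<times>\<^sub>F at_right 0)"
      by eventually_elim auto
  qed simp
  moreover have "eventually (\<lambda>h. (\<Sum>n. ?m n h) = expval (\<psi> h) (Q_op h A (\<psi> h))) (at_right 0)"
    using eventually_at_right_less[of "0::real"]
  proof eventually_elim
    case (elim h)
    with bdd obtain B where "\<forall>x. cmod (\<psi> h x) \<le> B" by blast
    then show ?case using expval_Q_op[OF \<psi>[OF elim] _ e A, of B h] by auto
  qed
  ultimately show ?thesis by (rule Lim_transform_eventually)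
qed

section \<open>Coherent states\<close>

lemma coh_measurable [measurable]: "coh h x0 p0 \<in> borel_measurable borel"
  unfolding coh_def by measurable

lemma cmod_coh_sq:
  assumes "h > 0"
  shows "(cmod (coh h x0 p0 x))\<^sup>2 = (pi * h) powr (-1/2) * exp (- (x - x0)\<^sup>2 / (2 * (h / 2)))"
proof -
  have "((pi * h) powr (-1/4))\<^sup>2 = (pi * h) powr (-1/2)"
    using assms by (simp add: powr_powr flip: powr_numeral)
  moreover have "(exp (- ((x - x0)\<^sup>2) / (2 * h)))\<^sup>2 = exp (- (x - x0)\<^sup>2 / (2 * (h / 2)))"
    by (simp flip: exp_of_nat_mult add: exp_double[symmetric])
  ultimately show ?thesis
    by (simp add: coh_def norm_mult power_mult_distrib)
qed

lemma pi_h_normalization: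
  assumes "h > 0"
  shows "(pi * h) powr (-1/2) * sqrt (pi * h) = 1"
  using assms by (simp add: powr_minus powr_half_sqrt field_simps)

lemma norm_sq_coh:
  assumes h: "h > 0"
  shows "sq_integrable (coh h x0 p0)" "norm_sq (coh h x0 p0) = 1"
proof -
  have "has_bochner_integral lborel (\<lambda>x. (cmod (coh h x0 p0 x))\<^sup>2) ((pi * h) powr (-1/2) * sqrt (2 * pi * (h / 2)))"
    unfolding cmod_coh_sq[OF h]
    by (intro has_bochner_integral_mult_right has_bochner_integral_gaussian) (use h in auto)
  then show "sq_integrable (coh h x0 p0)" "norm_sq (coh h x0 p0) = 1"
    using pi_h_normalization[OF h] by (auto simp: sq_integrable_def norm_sq_def has_bochner_integral_iff)
qed

lemma cmod_coh_le:
  assumes "h > 0"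
  shows "cmod (coh h x0 p0 x) \<le> (pi * h) powr (-1/4)"
  using assms by (simp add: coh_def norm_mult mult_left_le)

text \<open>Half of the exponent (x - m)^2 / h is spent on the factor exp (- d^2 / (2 h)). The other
  half leaves a Gaussian of variance h in place of h / 2, whose larger mass gives the constant sqrt
  2.\<close>

lemma gaussian_tail_le:
  assumes h: "h > 0" and [measurable]: "B \<in> sets borel"
    and d: "d \<ge> 0" "\<And>x. x \<in> B \<Longrightarrow> d \<le> \<bar>x - m\<bar>"
  shows "integrable lborel (\<lambda>x. indicator B x * ((pi * h) powr (-1/2) * exp (- (x - m)\<^sup>2 / (2 * (h / 2)))))" (is "integrable _ ?f")
    and "(LINT x|lborel. indicator B x * ((pi * h) powr (-1/2) * exp (- (x - m)\<^sup>2 / (2 * (h / 2)))))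
          \<le> sqrt 2 * exp (- d\<^sup>2 / (2 * h))"
proof -
  let ?c = "(pi * h) powr (-1/2)"
  let ?g = "\<lambda>x. ?c * exp (- d\<^sup>2 / (2 * h)) * exp (- (x - m)\<^sup>2 / (2 * h))"
  have g: "has_bochner_integral lborel ?g (?c * exp (- d\<^sup>2 / (2 * h)) * sqrt (2 * pi * h))"
    by (intro has_bochner_integral_mult_right has_bochner_integral_gaussian h)
  have le: "?f x \<le> ?g x" for x
  proof (cases "x \<in> B")
    case True
    have "d\<^sup>2 \<le> (x - m)\<^sup>2" using d(1) d(2)[OF True] by (metis abs_le_square_iff abs_of_nonneg)
    then have "- (x - m)\<^sup>2 / (2 * (h / 2)) \<le> - d\<^sup>2 / (2 * h) + - (x - m)\<^sup>2 / (2 * h)"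
      using h by (simp add: field_simps)
    then have "exp (- (x - m)\<^sup>2 / (2 * (h / 2))) \<le> exp (- d\<^sup>2 / (2 * h)) * exp (- (x - m)\<^sup>2 / (2 * h))"
      by (simp only: exp_add[symmetric] exp_le_cancel_iff)
    then show ?thesis using True by (simp add: mult.assoc mult_left_mono)
  qed simp
  show i: "integrable lborel ?f"
  proof (rule Bochner_Integration.integrable_bound)
    show "integrable lborel ?g" using g by (simp add: has_bochner_integral_iff)
    show "AE x in lborel. norm (?f x) \<le> norm (?g x)"
      using le by (intro AE_I2) (simp add: abs_mult)
  qed measurable
  have "(LINT x|lborel. ?f x) \<le> (LINT x|lborel. ?g x)"
    using i g le by (intro integral_mono) (auto simp: has_bochner_integral_iff)
  also have "\<dots> = ?c * exp (- d\<^sup>2 / (2 * h)) * sqrt (2 * pi * h)"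
    using g by (rule has_bochner_integral_integral_eq)
  also have "\<dots> = sqrt 2 * exp (- d\<^sup>2 / (2 * h)) * (?c * sqrt (pi * h))"
    by (simp add: real_sqrt_mult)
  finally show "(LINT x|lborel. ?f x) \<le> sqrt 2 * exp (- d\<^sup>2 / (2 * h))"
    using pi_h_normalization[OF h] by simp
qed

lemma tendsto_gaussian_tail:
  assumes "d > 0"
  shows "((\<lambda>h. exp (- d\<^sup>2 / (2 * h))) \<longlongrightarrow> 0) (at_right (0::real))"
  using assms by real_asymp

lemma norm_sq_coh_indicator:
  assumes h: "h > 0" and B[measurable]: "B \<in> sets borel"
    and d: "d \<ge> 0" "\<And>x. x \<in> B \<Longrightarrow> d \<le> \<bar>x - x0\<bar>"
  shows "sq_integrable (\<lambda>x. indicator B x * coh h x0 p0 x)"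
    "norm_sq (\<lambda>x. indicator B x * coh h x0 p0 x) \<le> sqrt 2 * exp (- d\<^sup>2 / (2 * h))"
proof -
  have eq: "(cmod (indicator B x * coh h x0 p0 x))\<^sup>2 =
     indicator B x * ((pi * h) powr (-1/2) * exp (- (x - x0)\<^sup>2 / (2 * (h / 2))))" for x
    by (simp add: norm_mult power_mult_distrib cmod_coh_sq[OF h] indicator_def)
  show "sq_integrable (\<lambda>x. indicator B x * coh h x0 p0 x)"
    "norm_sq (\<lambda>x. indicator B x * coh h x0 p0 x) \<le> sqrt 2 * exp (- d\<^sup>2 / (2 * h))"
    unfolding sq_integrable_def norm_sq_def eq
    using gaussian_tail_le[OF h B d] by auto
qed

text \<open>The Gaussians centred at x0 and x0 - h t multiply to exp (- h t^2 / 4) times a Gaussian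
  of variance h / 2 about the midpoint. Displacements are measured in units of \<open>h\<close>
  because V^b translates by 2 pi h b: the displacement vanishes with \<open>h\<close>, but the
  momentum phase p0 t stays.\<close>

lemma has_bochner_integral_coh_overlap:
  assumes h: "h > 0"
  shows "has_bochner_integral lborel
     (\<lambda>u. cnj (coh h x0 p0 u) * (exp (\<i> * complex_of_real (c * u)) * coh h x0 p0 (u + h * t)))
     (complex_of_real (exp (- h * t\<^sup>2 / 4) * exp (- c\<^sup>2 * h / 4)) * exp (\<i> * complex_of_real (p0 * t + c * (x0 - h * t / 2))))"
proof -
  let ?m = "x0 - h * t / 2"
  let ?K = "complex_of_real ((pi * h) powr (-1/2) * exp (- h * t\<^sup>2 / 4)) * exp (\<i> * complex_of_real (p0 * t))"
  have norm: "((pi * h) powr (-1/4)) * ((pi * h) powr (-1/4)) = (pi * h) powr (-1/2)"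
    using h by (simp flip: powr_add)
  have eq: "cnj (coh h x0 p0 u) * (exp (\<i> * complex_of_real (c * u)) * coh h x0 p0 (u + h * t)) =
      ?K * (complex_of_real (exp (- (u - ?m)\<^sup>2 / (2 * (h / 2)))) * exp (\<i> * complex_of_real (c * u)))" for u
  proof -
    define a where "a = p0 * u / h - p0 * x0 / (2 * h)"
    have ph: "p0 * (u + h * t) / h - p0 * x0 / (2 * h) = a + p0 * t"
      using h by (simp add: a_def field_simps)
    have "- ((u - x0)\<^sup>2) / (2 * h) + - ((u + h * t - x0)\<^sup>2) / (2 * h)
        = - h * t\<^sup>2 / 4 + - (u - ?m)\<^sup>2 / (2 * (h / 2))"
      using h by (simp add: field_simps power2_eq_square)
    then have "exp (- ((u - x0)\<^sup>2) / (2 * h)) * exp (- ((u + h * t - x0)\<^sup>2) / (2 * h))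
        = exp (- h * t\<^sup>2 / 4) * exp (- (u - ?m)\<^sup>2 / (2 * (h / 2)))"
      by (simp only: exp_add[symmetric])
    then have ge: "complex_of_real (exp (- ((u - x0)\<^sup>2) / (2 * h))) * complex_of_real (exp (- ((u + h * t - x0)\<^sup>2) / (2 * h)))
        = complex_of_real (exp (- h * t\<^sup>2 / 4)) * complex_of_real (exp (- (u - ?m)\<^sup>2 / (2 * (h / 2))))"
      by (simp only: of_real_mult[symmetric])
    have pe: "cnj (exp (\<i> * complex_of_real a)) * exp (\<i> * complex_of_real (a + p0 * t)) = exp (\<i> * complex_of_real (p0 * t))"
      by (simp add: exp_cnj exp_add[symmetric] algebra_simps)
    have "cnj (coh h x0 p0 u) * (exp (\<i> * complex_of_real (c * u)) * coh h x0 p0 (u + h * t)) =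
       complex_of_real ((pi * h) powr (-1/4) * (pi * h) powr (-1/4)) *
       (complex_of_real (exp (- ((u - x0)\<^sup>2) / (2 * h))) * complex_of_real (exp (- ((u + h * t - x0)\<^sup>2) / (2 * h)))) *
       (cnj (exp (\<i> * complex_of_real a)) * exp (\<i> * complex_of_real (a + p0 * t))) * exp (\<i> * complex_of_real (c * u))"
      unfolding coh_def ph a_def[symmetric] by (simp add: mult_ac)
    then show ?thesis unfolding norm ge pe by (simp add: mult_ac)
  qed
  have "has_bochner_integral lborel (\<lambda>u. cnj (coh h x0 p0 u) * (exp (\<i> * complex_of_real (c * u)) * coh h x0 p0 (u + h * t)))
     (?K * (complex_of_real (sqrt (2 * pi * (h / 2)) * exp (- (c\<^sup>2 * (h / 2) / 2))) * exp (\<i> * complex_of_real (c * ?m))))"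
    unfolding eq
    by (intro has_bochner_integral_mult_right has_bochner_integral_gaussian_fourier) (use h in auto)
  also have "?K * (complex_of_real (sqrt (2 * pi * (h / 2)) * exp (- (c\<^sup>2 * (h / 2) / 2))) * exp (\<i> * complex_of_real (c * ?m)))
     = complex_of_real ((pi * h) powr (-1/2) * sqrt (pi * h)) *
       (complex_of_real (exp (- h * t\<^sup>2 / 4) * exp (- c\<^sup>2 * h / 4)) * (exp (\<i> * complex_of_real (p0 * t)) * exp (\<i> * complex_of_real (c * ?m))))"
    by (simp add: mult_ac)
  also have "\<dots> = complex_of_real (exp (- h * t\<^sup>2 / 4) * exp (- c\<^sup>2 * h / 4)) * exp (\<i> * complex_of_real (p0 * t + c * ?m))"
    unfolding pi_h_normalization[OF h] by (simp add: exp_add[symmetric] distrib_left)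
  finally show ?thesis .
qed

lemma tendsto_coh_overlap:
  "((\<lambda>h. LINT u|lborel. cnj (coh h x0 p0 u) * (exp (\<i> * complex_of_real (c * u)) * coh h x0 p0 (u + h * t)))
     \<longlongrightarrow> exp (\<i> * complex_of_real (p0 * t + c * x0))) (at_right 0)"
proof -
  let ?I = "\<lambda>h. complex_of_real (exp (- h * t\<^sup>2 / 4) * exp (- c\<^sup>2 * h / 4)) * exp (\<i> * complex_of_real (p0 * t + c * (x0 - h * t / 2)))"
  have "(?I \<longlongrightarrow> complex_of_real (exp (- 0 * t\<^sup>2 / 4) * exp (- c\<^sup>2 * 0 / 4)) * exp (\<i> * complex_of_real (p0 * t + c * (x0 - 0 * t / 2)))) (at_right 0)"
    by (intro tendsto_intros) auto
  then have "(?I \<longlongrightarrow> exp (\<i> * complex_of_real (p0 * t + c * x0))) (at_right 0)" by simp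
  moreover have "eventually (\<lambda>h. ?I h = (LINT u|lborel. cnj (coh h x0 p0 u) * (exp (\<i> * complex_of_real (c * u)) * coh h x0 p0 (u + h * t)))) (at_right 0)"
    using eventually_at_right_less[of "0::real"]
    by eventually_elim (rule has_bochner_integral_integral_eq[symmetric], rule has_bochner_integral_coh_overlap)
  ultimately show ?thesis by (rule Lim_transform_eventually)
qed

section \<open>An upper Plancherel bound\<close>

text \<open>Fubini with the majorant C |u x| |g q|. It is applied with a pure phase as kernel, and
  with a phase times a bounded Fourier integral.\<close>

lemma integral_swap_product:
  fixes u :: "real \<Rightarrow> real" and g :: "real \<Rightarrow> complex" and k :: "real \<Rightarrow> real \<Rightarrow> complex"
  assumes u: "integrable lborel u" and g: "integrable lborel g"
    and k[measurable]: "case_prod k \<in> borel_measurable (borel \<Otimes>\<^sub>M borel)" and C: "\<And>x q. cmod (k x q) \<le> C"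
  shows "(LINT x|lborel. complex_of_real (u x) * (LINT q|lborel. g q * k x q)) =
         (LINT q|lborel. g q * (LINT x|lborel. complex_of_real (u x) * k x q))"
proof -
  have [measurable]: "u \<in> borel_measurable borel" "g \<in> borel_measurable borel"
    using u g by (auto dest: borel_measurable_integrable)
  have "C \<ge> 0" using C[of 0 0] norm_ge_zero order_trans by blast
  let ?f = "\<lambda>x q. complex_of_real (u x) * (g q * k x q)"
  have bd: "norm (?f x q) \<le> \<bar>u x\<bar> * (C * cmod (g q))" for x q
    using mult_left_mono[OF C[of x q], of "\<bar>u x\<bar> * cmod (g q)"] by (simp add: norm_mult mult_ac)
  have gC: "integrable lborel (\<lambda>q. C * cmod (g q))" using g by simp
  have i1: "integrable lborel (?f x)" for x
  proof (rule Bochner_Integration.integrable_bound)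
    show "integrable lborel (\<lambda>q. \<bar>u x\<bar> * (C * cmod (g q)))" using gC by (rule integrable_mult_right)
    show "AE q in lborel. norm (?f x q) \<le> norm (\<bar>u x\<bar> * (C * cmod (g q)))"
      using bd \<open>C \<ge> 0\<close> by (intro AE_I2) (simp add: abs_mult)
  qed measurable
  have "integrable (lborel \<Otimes>\<^sub>M lborel) (\<lambda>(x, q). ?f x q)"
  proof (rule lborel_pair.Fubini_integrable)
    show "integrable lborel (\<lambda>x. LINT q|lborel. norm (case (x, q) of (x, q) \<Rightarrow> ?f x q))"
    proof (rule Bochner_Integration.integrable_bound)
      show "integrable lborel (\<lambda>x. \<bar>u x\<bar> * (LINT q|lborel. C * cmod (g q)))"
        using u by simp
      show "AE x in lborel. norm (LINT q|lborel. norm (case (x, q) of (x, q) \<Rightarrow> ?f x q))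
               \<le> norm (\<bar>u x\<bar> * (LINT q|lborel. C * cmod (g q)))"
      proof (rule AE_I2)
        fix x
        have "(LINT q|lborel. norm (?f x q)) \<le> (LINT q|lborel. \<bar>u x\<bar> * (C * cmod (g q)))"
          by (intro integral_mono integrable_norm i1 integrable_mult_right gC bd)
        also have "\<dots> = \<bar>u x\<bar> * (LINT q|lborel. C * cmod (g q))"
          by simp
        finally have "(LINT q|lborel. norm (?f x q)) \<le> \<bar>u x\<bar> * (LINT q|lborel. C * cmod (g q))" .
        moreover have "0 \<le> (LINT q|lborel. norm (?f x q))" by simp
        ultimately show "norm (LINT q|lborel. norm (case (x, q) of (x, q) \<Rightarrow> ?f x q))
               \<le> norm (\<bar>u x\<bar> * (LINT q|lborel. C * cmod (g q)))"
          unfolding prod.case real_norm_def by linarith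
      qed
    qed measurable
    show "AE x in lborel. integrable lborel (\<lambda>q. case (x, q) of (x, q) \<Rightarrow> ?f x q)"
      using i1 by simp
  qed measurable
  from lborel_pair.Fubini_integral[OF this]
  have "(LINT x|lborel. LINT q|lborel. ?f x q) = (LINT q|lborel. LINT x|lborel. ?f x q)"
    by simp
  moreover have "complex_of_real (u x) * (LINT q|lborel. g q * k x q) = (LINT q|lborel. ?f x q)" for x
    by simp
  moreover have "g q * (LINT x|lborel. complex_of_real (u x) * k x q) = (LINT x|lborel. ?f x q)" for q
  proof -
    have "g q * (LINT x|lborel. complex_of_real (u x) * k x q) = (LINT x|lborel. g q * (complex_of_real (u x) * k x q))"
      by simp
    also have "\<dots> = (LINT x|lborel. ?f x q)"
      by (rule Bochner_Integration.integral_cong) (auto simp: mult_ac)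
    finally show ?thesis .
  qed
  ultimately show ?thesis by (simp only:)
qed

text \<open>If \<open>f\<close> is not integrable, the left side is the default value 0. This lets
  iterated integrals be bounded from outside in, without an integrability proof at each
  level.\<close>

lemma cmod_integral_le_nn_integral:
  fixes f :: "'a \<Rightarrow> complex"
  shows "ennreal (cmod (LINT x|M. f x)) \<le> (\<integral>\<^sup>+x. ennreal (cmod (f x)) \<partial>M)"
proof (cases "integrable M f")
  case True
  then show ?thesis by (rule integral_norm_bound_ennreal)
qed (simp add: not_integrable_integral_eq)

text \<open>Schur's test: |g q| |g p| is at most the mean of the two squares, and the symmetric
  kernel has mass sqrt (2 pi v) * sqrt (2 pi / v) = 2 pi in either variable. That this mass does not
  depend on \<open>v\<close> is what later allows the weight to be removed.\<close>

lemma gaussian_kernel_Schur: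
  assumes v: "v > 0" and g: "sq_integrable g"
  shows "(\<integral>\<^sup>+q. \<integral>\<^sup>+p. ennreal (cmod (g q) * cmod (g p) * (sqrt (2 * pi * v) * exp (- ((p - q)\<^sup>2 * v / 2)))) \<partial>lborel \<partial>lborel)
     \<le> ennreal (2 * pi * norm_sq g)"
proof -
  note [measurable] = sq_integrable_measurable[OF g]
  define K where "K = (\<lambda>p q. sqrt (2 * pi * v) * exp (- ((p - q)\<^sup>2 * v / 2)))"
  have [measurable]: "case_prod K \<in> borel_measurable (borel \<Otimes>\<^sub>M borel)"
    unfolding K_def by measurable
  have K0: "0 \<le> K p q" for p q using v by (simp add: K_def)
  have Ksym: "K p q = K q p" for p q by (simp add: K_def power2_commute)
  have "has_bochner_integral lborel (\<lambda>p. K p q) (sqrt (2 * pi * v) * sqrt (2 * pi * (1 / v)))" for q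
    using has_bochner_integral_mult_right[where c = "sqrt (2 * pi * v)", OF has_bochner_integral_gaussian[of "1 / v" q]] v
    by (simp add: K_def)
  moreover have "sqrt (2 * pi * v) * sqrt (2 * pi * (1 / v)) = 2 * pi"
  proof -
    have "sqrt (2 * pi * v) * sqrt (2 * pi * (1 / v)) = sqrt ((2 * pi * v) * (2 * pi * (1 / v)))"
      by (rule real_sqrt_mult[symmetric])
    also have "(2 * pi * v) * (2 * pi * (1 / v)) = (2 * pi)\<^sup>2"
      using v by (simp add: power2_eq_square)
    also have "sqrt \<dots> = 2 * pi"
      by (rule real_sqrt_unique) simp_all
    finally show ?thesis .
  qed
  ultimately have K2: "has_bochner_integral lborel (\<lambda>p. K p q) (2 * pi)" for q
    by (simp only:)
  have K1: "(\<integral>\<^sup>+p. ennreal (K p q) \<partial>lborel) = ennreal (2 * pi)" for q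
    using nn_integral_eq_integral[of lborel "\<lambda>p. K p q"] K2[of q] K0
    by (simp add: has_bochner_integral_iff)
  define G where "G = (\<lambda>q. (cmod (g q))\<^sup>2 / 2)"
  have [measurable]: "G \<in> borel_measurable borel" unfolding G_def by measurable
  have G0: "0 \<le> G q" for q by (simp add: G_def)
  have NG: "(\<integral>\<^sup>+q. ennreal (G q) \<partial>lborel) = ennreal (norm_sq g / 2)"
    using g G0 by (subst nn_integral_eq_integral) (auto simp: sq_integrable_def norm_sq_def G_def)
  have half: "(\<integral>\<^sup>+q. \<integral>\<^sup>+p. ennreal (G q) * ennreal (K p q) \<partial>lborel \<partial>lborel) = ennreal (norm_sq g / 2) * ennreal (2 * pi)"
    by (simp add: nn_integral_cmult nn_integral_multc K1 NG)
  \<comment> \<open>Tonelli and the symmetry of \<open>K\<close> reduce this half to the previous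
    one.\<close>
  have "(\<integral>\<^sup>+q. \<integral>\<^sup>+p. ennreal (G p) * ennreal (K p q) \<partial>lborel \<partial>lborel)
      = (\<integral>\<^sup>+p. \<integral>\<^sup>+q. ennreal (G p) * ennreal (K p q) \<partial>lborel \<partial>lborel)"
    by (rule lborel_pair.Fubini'[symmetric]) measurable
  also have "\<dots> = (\<integral>\<^sup>+q. \<integral>\<^sup>+p. ennreal (G q) * ennreal (K p q) \<partial>lborel \<partial>lborel)"
    by (subst (2) Ksym) simp
  finally have half': "(\<integral>\<^sup>+q. \<integral>\<^sup>+p. ennreal (G p) * ennreal (K p q) \<partial>lborel \<partial>lborel) = ennreal (norm_sq g / 2) * ennreal (2 * pi)"
    unfolding half .
  have le: "ennreal (cmod (g q) * cmod (g p) * K p q) \<le> ennreal (G q) * ennreal (K p q) + ennreal (G p) * ennreal (K p q)" for p q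
  proof -
    have "cmod (g q) * cmod (g p) \<le> G q + G p"
      using sum_squares_bound[of "cmod (g q)" "cmod (g p)"] by (simp add: G_def)
    then have "cmod (g q) * cmod (g p) * K p q \<le> G q * K p q + G p * K p q"
      using K0[of p q] by (metis distrib_right mult_right_mono)
    then show ?thesis using G0 K0
      by (simp add: ennreal_mult[symmetric] ennreal_plus[symmetric] del: ennreal_plus)
  qed
  have "(\<integral>\<^sup>+q. \<integral>\<^sup>+p. ennreal (cmod (g q) * cmod (g p) * K p q) \<partial>lborel \<partial>lborel)
     \<le> (\<integral>\<^sup>+q. \<integral>\<^sup>+p. ennreal (G q) * ennreal (K p q) + ennreal (G p) * ennreal (K p q) \<partial>lborel \<partial>lborel)"
    by (intro nn_integral_mono le)
  also have "\<dots> = ennreal (norm_sq g / 2) * ennreal (2 * pi) + ennreal (norm_sq g / 2) * ennreal (2 * pi)"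
  proof -
    have "(\<integral>\<^sup>+q. \<integral>\<^sup>+p. ennreal (G q) * ennreal (K p q) + ennreal (G p) * ennreal (K p q) \<partial>lborel \<partial>lborel)
      = (\<integral>\<^sup>+q. (\<integral>\<^sup>+p. ennreal (G q) * ennreal (K p q) \<partial>lborel) + (\<integral>\<^sup>+p. ennreal (G p) * ennreal (K p q) \<partial>lborel) \<partial>lborel)"
      by (intro nn_integral_cong nn_integral_add) measurable
    also have "\<dots> = (\<integral>\<^sup>+q. \<integral>\<^sup>+p. ennreal (G q) * ennreal (K p q) \<partial>lborel \<partial>lborel)
        + (\<integral>\<^sup>+q. \<integral>\<^sup>+p. ennreal (G p) * ennreal (K p q) \<partial>lborel \<partial>lborel)"
      by (rule nn_integral_add) measurable
    finally show ?thesis unfolding half half' .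
  qed
  also have "\<dots> = ennreal (2 * pi * norm_sq g)"
    by (simp add: ennreal_mult[symmetric] ennreal_plus[symmetric] field_simps del: ennreal_plus)
  finally show ?thesis unfolding K_def .
qed

text \<open>The weight exp (-x^2/2v) makes the triple integral absolutely convergent, so Fubini turns
  the left-hand side into a quadratic form in g with a Gaussian kernel of total mass 2 pi.\<close>

lemma fourier_regularized_le:
  assumes v: "v > 0" and g1: "integrable lborel g" and g2: "sq_integrable g"
  defines "H \<equiv> \<lambda>x. LINT p|lborel. g p * exp (\<i> * complex_of_real (p * x))"
  shows "(\<integral>\<^sup>+x. ennreal (exp (- x\<^sup>2 / (2 * v)) * (cmod (H x))\<^sup>2) \<partial>lborel) \<le> ennreal (2 * pi * norm_sq g)"
proof -
  note [measurable] = sq_integrable_measurable[OF g2]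
  have H[measurable]: "H \<in> borel_measurable borel" unfolding H_def by measurable
  \<comment> \<open>The L1 norm of \<open>g\<close> bounds \<open>H\<close> everywhere; it is the
    kernel bound when the integral expressing cnj H is interchanged with the weighted one.\<close>
  define N where "N = (LINT p|lborel. cmod (g p))"
  have Hb: "cmod (H x) \<le> N" for x
    unfolding H_def N_def
    by (rule order_trans[OF integral_norm_bound]) (simp add: norm_mult)
  define w where "w = (\<lambda>x::real. exp (- x\<^sup>2 / (2 * v)))"
  have w: "integrable lborel w"
    using has_bochner_integral_gaussian[OF v, of 0] by (simp add: w_def has_bochner_integral_iff)
  have [measurable]: "w \<in> borel_measurable borel" unfolding w_def by measurable
  define K where "K = (\<lambda>p q. complex_of_real (sqrt (2 * pi * v) * exp (- ((p - q)\<^sup>2 * v / 2))))"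
  \<comment> \<open>The position variable is integrated out: the Fourier transform of the weight at
    frequency p - q is the kernel \<open>K\<close>.\<close>
  have inner: "(LINT x|lborel. complex_of_real (w x) * (H x * exp (- \<i> * complex_of_real (q * x))))
       = (LINT p|lborel. g p * K p q)" for q
  proof -
    have "H x * exp (- \<i> * complex_of_real (q * x)) = (LINT p|lborel. g p * exp (\<i> * complex_of_real ((p - q) * x)))" for x
      unfolding H_def
      by (subst integral_mult_left_zero[symmetric]) (simp add: mult.assoc exp_add[symmetric] algebra_simps)
    moreover have "(LINT x|lborel. complex_of_real (w x) * (LINT p|lborel. g p * exp (\<i> * complex_of_real ((p - q) * x))))
       = (LINT p|lborel. g p * (LINT x|lborel. complex_of_real (w x) * exp (\<i> * complex_of_real ((p - q) * x))))"
      by (rule integral_swap_product[OF w g1, where C = 1]) auto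
    moreover have "(LINT x|lborel. complex_of_real (w x) * exp (\<i> * complex_of_real ((p - q) * x))) = K p q" for p
      using has_bochner_integral_gaussian_fourier[OF v, of 0 "p - q"]
      by (simp add: w_def K_def has_bochner_integral_iff)
    ultimately show ?thesis by simp
  qed
  have cH: "cnj (H x) = (LINT q|lborel. cnj (g q) * exp (- \<i> * complex_of_real (q * x)))" for x
  proof -
    have "(LINT q|lborel. cnj (g q) * exp (- \<i> * complex_of_real (q * x))) = (LINT q|lborel. cnj (g q * exp (\<i> * complex_of_real (q * x))))"
      by (rule Bochner_Integration.integral_cong) (auto simp: exp_cnj)
    also have "\<dots> = cnj (LINT q|lborel. g q * exp (\<i> * complex_of_real (q * x)))"
      by (rule Bochner_Integration.integral_cnj)
    finally show ?thesis unfolding H_def by (rule sym)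
  qed
  have "(LINT x|lborel. complex_of_real (w x) * (H x * cnj (H x))) =
     (LINT x|lborel. complex_of_real (w x) * (LINT q|lborel. cnj (g q) * (H x * exp (- \<i> * complex_of_real (q * x)))))"
    unfolding cH by (subst integral_mult_right_zero[symmetric]) (simp add: mult_ac)
  also have "\<dots> = (LINT q|lborel. cnj (g q) * (LINT x|lborel. complex_of_real (w x) * (H x * exp (- \<i> * complex_of_real (q * x)))))"
    by (rule integral_swap_product[OF w, where C = N]) (use g1 Hb in \<open>auto simp: norm_mult\<close>)
  finally have eq: "(LINT x|lborel. complex_of_real (w x) * (H x * cnj (H x))) =
      (LINT q|lborel. cnj (g q) * (LINT p|lborel. g p * K p q))"
    unfolding inner .
  have iw: "integrable lborel (\<lambda>x. w x * (cmod (H x))\<^sup>2)"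
  proof (rule Bochner_Integration.integrable_bound)
    show "integrable lborel (\<lambda>x. w x * N\<^sup>2)" using w by simp
    show "AE x in lborel. norm (w x * (cmod (H x))\<^sup>2) \<le> norm (w x * N\<^sup>2)"
      using Hb by (intro AE_I2) (auto simp: w_def abs_mult intro!: power_mono)
  qed measurable
  have nn: "0 \<le> (LINT x|lborel. w x * (cmod (H x))\<^sup>2)"
    by (simp add: w_def)
  have "complex_of_real (LINT x|lborel. w x * (cmod (H x))\<^sup>2) = (LINT x|lborel. complex_of_real (w x) * (H x * cnj (H x)))"
    by (simp only: integral_complex_of_real[symmetric] of_real_mult complex_norm_square)
  then have "ennreal (LINT x|lborel. w x * (cmod (H x))\<^sup>2) = ennreal (cmod (LINT q|lborel. cnj (g q) * (LINT p|lborel. g p * K p q)))"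
    unfolding eq using nn by (metis abs_of_nonneg norm_of_real)
  also have "\<dots> \<le> (\<integral>\<^sup>+q. ennreal (cmod (cnj (g q) * (LINT p|lborel. g p * K p q))) \<partial>lborel)"
    by (rule cmod_integral_le_nn_integral)
  also have "\<dots> \<le> (\<integral>\<^sup>+q. \<integral>\<^sup>+p. ennreal (cmod (g q) * cmod (g p) * (sqrt (2 * pi * v) * exp (- ((p - q)\<^sup>2 * v / 2)))) \<partial>lborel \<partial>lborel)"
  proof (rule nn_integral_mono)
    fix q
    have "cnj (g q) * (LINT p|lborel. g p * K p q) = (LINT p|lborel. cnj (g q) * (g p * K p q))"
      by simp
    then have "ennreal (cmod (cnj (g q) * (LINT p|lborel. g p * K p q))) \<le> (\<integral>\<^sup>+p. ennreal (cmod (cnj (g q) * (g p * K p q))) \<partial>lborel)"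
      by (simp only: cmod_integral_le_nn_integral)
    also have "\<dots> = (\<integral>\<^sup>+p. ennreal (cmod (g q) * cmod (g p) * (sqrt (2 * pi * v) * exp (- ((p - q)\<^sup>2 * v / 2)))) \<partial>lborel)"
      using v by (simp add: K_def norm_mult mult_ac)
    finally show "ennreal (cmod (cnj (g q) * (LINT p|lborel. g p * K p q))) \<le> \<dots>" .
  qed
  also have "\<dots> \<le> ennreal (2 * pi * norm_sq g)"
    by (rule gaussian_kernel_Schur[OF v g2])
  finally show ?thesis
    using nn_integral_eq_integral[OF iw] by (simp add: w_def)
qed

text \<open>The regularized bound is uniform in \<open>v\<close>, so Fatou's lemma along v = n + 1,
  where the weight tends to 1 pointwise, removes the weight.\<close>

lemma fourier_norm_sq_le:
  assumes g1: "integrable lborel g" and g2: "sq_integrable g"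
  defines "H \<equiv> \<lambda>x. LINT p|lborel. g p * exp (\<i> * complex_of_real (p * x))"
  shows "sq_integrable H" "norm_sq H \<le> 2 * pi * norm_sq g"
proof -
  note [measurable] = sq_integrable_measurable[OF g2]
  have H[measurable]: "H \<in> borel_measurable borel" unfolding H_def by measurable
  let ?u = "\<lambda>n x. ennreal (exp (- x\<^sup>2 / (2 * real (Suc n))) * (cmod (H x))\<^sup>2)"
  have lim: "(\<lambda>n. ?u n x) \<longlonglongrightarrow> ennreal ((cmod (H x))\<^sup>2)" for x
  proof (rule tendsto_ennrealI)
    have "(\<lambda>n. exp (- x\<^sup>2 / (2 * real (Suc n)))) \<longlonglongrightarrow> 1" by real_asymp
    from tendsto_mult_right[OF this, of "(cmod (H x))\<^sup>2"]
    show "(\<lambda>n. exp (- x\<^sup>2 / (2 * real (Suc n))) * (cmod (H x))\<^sup>2) \<longlonglongrightarrow> (cmod (H x))\<^sup>2" by simp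
  qed
  have "(\<integral>\<^sup>+x. ennreal ((cmod (H x))\<^sup>2) \<partial>lborel) = (\<integral>\<^sup>+x. liminf (\<lambda>n. ?u n x) \<partial>lborel)"
    by (intro nn_integral_cong lim_imp_Liminf[symmetric] lim) simp
  also have "\<dots> \<le> liminf (\<lambda>n. \<integral>\<^sup>+x. ?u n x \<partial>lborel)"
    by (rule nn_integral_liminf) measurable
  also have "\<dots> \<le> liminf (\<lambda>n. ennreal (2 * pi * norm_sq g))"
    unfolding H_def by (intro Liminf_mono always_eventually allI fourier_regularized_le g1 g2) simp
  also have "\<dots> = ennreal (2 * pi * norm_sq g)" by (simp add: Liminf_const)
  finally have le: "(\<integral>\<^sup>+x. ennreal ((cmod (H x))\<^sup>2) \<partial>lborel) \<le> ennreal (2 * pi * norm_sq g)" .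
  have i: "integrable lborel (\<lambda>x. (cmod (H x))\<^sup>2)"
    using le by (intro integrableI_bounded) (auto intro: le_less_trans)
  then show "sq_integrable H" by (simp add: sq_integrable_def)
  show "norm_sq H \<le> 2 * pi * norm_sq g"
    using le nn_integral_eq_integral[OF i] by (simp add: norm_sq_def)
qed

section \<open>Momentum projections of coherent states\<close>

text \<open>The Fourier transform of \<open>coh\<close> at frequency p / h in closed form. The
  normalization 1 / sqrt (2 pi h) is left out, whence the factor sqrt (2 pi h).\<close>

definition coh_hat :: "real \<Rightarrow> real \<Rightarrow> real \<Rightarrow> wavefn" where
  "coh_hat h x0 p0 p = complex_of_real ((pi * h) powr (-1/4) * sqrt (2 * pi * h) * exp (- (p - p0)\<^sup>2 / (2 * h))) *
     exp (\<i> * complex_of_real ((p0 / 2 - p) * x0 / h))"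

lemma coh_hat_measurable [measurable]: "coh_hat h x0 p0 \<in> borel_measurable borel"
  unfolding coh_hat_def by measurable

lemma integral_fourier_coh:
  assumes h: "h > 0"
  shows "(LINT y|lborel. exp (- \<i> * complex_of_real (p * y / h)) * coh h x0 p0 y) = coh_hat h x0 p0 p"
proof -
  let ?K = "complex_of_real ((pi * h) powr (-1/4)) * exp (- \<i> * complex_of_real (p0 * x0 / (2 * h)))"
  have eq: "exp (- \<i> * complex_of_real (p * y / h)) * coh h x0 p0 y =
      ?K * (complex_of_real (exp (- (y - x0)\<^sup>2 / (2 * h))) * exp (\<i> * complex_of_real ((p0 - p) / h * y)))" for y
  proof -
    have "exp (- \<i> * complex_of_real (p * y / h)) * exp (\<i> * complex_of_real (p0 * y / h - p0 * x0 / (2 * h)))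
       = exp (- \<i> * complex_of_real (p0 * x0 / (2 * h))) * exp (\<i> * complex_of_real ((p0 - p) / h * y))"
      by (simp add: exp_add[symmetric] algebra_simps diff_divide_distrib)
    then show ?thesis by (simp add: coh_def mult_ac)
  qed
  have "(LINT y|lborel. exp (- \<i> * complex_of_real (p * y / h)) * coh h x0 p0 y) =
     ?K * (complex_of_real (sqrt (2 * pi * h) * exp (- (((p0 - p) / h)\<^sup>2 * h / 2))) * exp (\<i> * complex_of_real ((p0 - p) / h * x0)))"
    unfolding eq
    by (intro has_bochner_integral_integral_eq has_bochner_integral_mult_right has_bochner_integral_gaussian_fourier h)
  also have "((p0 - p) / h)\<^sup>2 * h / 2 = (p - p0)\<^sup>2 / (2 * h)"
    using h by (simp add: power_divide power2_commute[of p0 p] power2_eq_square[of h])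
  also have "exp (\<i> * complex_of_real ((p0 - p) / h * x0)) = exp (\<i> * complex_of_real (p0 * x0 / (2 * h))) * exp (\<i> * complex_of_real ((p0 / 2 - p) * x0 / h))"
  proof -
    have "(p0 - p) / h * x0 = p0 * x0 / (2 * h) + (p0 / 2 - p) * x0 / h"
      using h by (simp add: field_simps)
    then show ?thesis by (simp only: of_real_add distrib_left exp_add)
  qed
  finally show ?thesis
    by (simp add: coh_hat_def exp_minus)
qed

text \<open>A coherent state has the same profile in momentum as in position, so the position tail
  estimate carries over with p0 as centre.\<close>

lemma cmod_coh_hat:
  assumes h: "h > 0"
  shows "cmod (coh_hat h x0 p0 p) = sqrt (2 * pi * h) * cmod (coh h p0 0 p)"
  using h by (simp add: coh_hat_def coh_def norm_mult)

lemma integrable_coh_hat: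
  assumes h: "h > 0" and [measurable]: "B \<in> sets borel"
  shows "integrable lborel (\<lambda>p. indicator B p * coh_hat h x0 p0 p)"
proof (rule Bochner_Integration.integrable_bound)
  show "integrable lborel (\<lambda>p. ((pi * h) powr (-1/4) * sqrt (2 * pi * h)) * exp (- (p - p0)\<^sup>2 / (2 * h)))"
    using has_bochner_integral_gaussian[OF h, of p0] by (simp add: has_bochner_integral_iff)
  show "AE p in lborel. norm (indicator B p * coh_hat h x0 p0 p)
      \<le> norm (((pi * h) powr (-1/4) * sqrt (2 * pi * h)) * exp (- (p - p0)\<^sup>2 / (2 * h)))"
    using h by (intro AE_I2) (simp add: coh_hat_def norm_mult indicator_def)
qed measurable

lemma norm_sq_coh_hat_indicator:
  assumes h: "h > 0" and B[measurable]: "B \<in> sets borel"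
    and d: "d \<ge> 0" "\<And>p. p \<in> B \<Longrightarrow> d \<le> \<bar>p - p0\<bar>"
  shows "sq_integrable (\<lambda>p. indicator B p * coh_hat h x0 p0 p)"
    "norm_sq (\<lambda>p. indicator B p * coh_hat h x0 p0 p) \<le> 2 * pi * h * (sqrt 2 * exp (- d\<^sup>2 / (2 * h)))"
proof -
  note ind = norm_sq_coh_indicator[OF h B d, of 0]
  let ?g = "\<lambda>p. complex_of_real (sqrt (2 * pi * h)) * (indicator B p * coh h p0 0 p)"
  have le: "cmod (indicator B p * coh_hat h x0 p0 p) \<le> cmod (?g p)" for p
    using h by (simp add: norm_mult cmod_coh_hat)
  note * = norm_sq_mono[OF norm_sq_cmult(1)[OF ind(1), of "complex_of_real (sqrt (2 * pi * h))"] _ le]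
  show "sq_integrable (\<lambda>p. indicator B p * coh_hat h x0 p0 p)"
    by (rule *(1)) measurable
  have "norm_sq (\<lambda>p. indicator B p * coh_hat h x0 p0 p) \<le> norm_sq ?g"
    by (rule *(2)) measurable
  also have "\<dots> = 2 * pi * h * norm_sq (\<lambda>p. indicator B p * coh h p0 0 p)"
  proof -
    have "(cmod (complex_of_real (sqrt (2 * pi * h))))\<^sup>2 = 2 * pi * h"
      using h by (simp only: norm_of_real power2_abs real_sqrt_pow2_iff) simp
    then show ?thesis by (simp only: norm_sq_cmult(2)[OF ind(1)])
  qed
  also have "\<dots> \<le> 2 * pi * h * (sqrt 2 * exp (- d\<^sup>2 / (2 * h)))"
    using ind(2) h by (intro mult_left_mono) auto
  finally show "norm_sq (\<lambda>p. indicator B p * coh_hat h x0 p0 p) \<le> 2 * pi * h * (sqrt 2 * exp (- d\<^sup>2 / (2 * h)))" .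
qed

lemma spec_proj_coh_eq:
  assumes h: "h > 0"
  shows "spec_proj_p h B (coh h x0 p0) x = complex_of_real (1 / (2 * pi * h)) *
     (LINT p|lborel. (indicator B p * coh_hat h x0 p0 p) * exp (\<i> * complex_of_real (p * (x / h))))"
  unfolding spec_proj_p_def integral_fourier_coh[OF h] by (simp add: mult_ac)

text \<open>All constants cancel: the prefactor contributes (2 pi h)^(-2), the rescaling x / h
  contributes h, Plancherel contributes 2 pi, and \<open>coh_hat\<close> contributes 2 pi h. The
  bound is therefore the one for a cutoff in position.\<close>

lemma norm_sq_spec_proj_coh:
  assumes h: "h > 0" and B[measurable]: "B \<in> sets borel"
    and d: "d \<ge> 0" "\<And>p. p \<in> B \<Longrightarrow> d \<le> \<bar>p - p0\<bar>"
  shows "sq_integrable (spec_proj_p h B (coh h x0 p0))"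
    "norm_sq (spec_proj_p h B (coh h x0 p0)) \<le> sqrt 2 * exp (- d\<^sup>2 / (2 * h))"
proof -
  let ?g = "\<lambda>p. indicator B p * coh_hat h x0 p0 p"
  let ?H = "\<lambda>x. LINT p|lborel. ?g p * exp (\<i> * complex_of_real (p * x))"
  note g = norm_sq_coh_hat_indicator[OF h B d, of x0]
  note H = fourier_norm_sq_le[OF integrable_coh_hat[OF h B] g(1)]
  have h': "1 / h \<noteq> 0" using h by simp
  note Hs = norm_sq_affine[OF H(1) h', of 0]
  have eq: "spec_proj_p h B (coh h x0 p0) = (\<lambda>x. complex_of_real (1 / (2 * pi * h)) * ?H (0 + 1 / h * x))"
    by (rule ext) (simp add: spec_proj_coh_eq[OF h])
  show "sq_integrable (spec_proj_p h B (coh h x0 p0))"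
    unfolding eq by (rule norm_sq_cmult(1)[OF Hs(1)])
  have "norm_sq (spec_proj_p h B (coh h x0 p0)) =
      (cmod (complex_of_real (1 / (2 * pi * h))))\<^sup>2 * norm_sq (\<lambda>x. ?H (0 + 1 / h * x))"
    unfolding eq by (rule norm_sq_cmult(2)[OF Hs(1)])
  also have "norm_sq (\<lambda>x. ?H (0 + 1 / h * x)) = norm_sq ?H / \<bar>1 / h\<bar>"
    by (rule Hs(2))
  also have "(cmod (complex_of_real (1 / (2 * pi * h))))\<^sup>2 = (1 / (2 * pi * h))\<^sup>2"
    by (simp only: norm_of_real power2_abs)
  also have "(1 / (2 * pi * h))\<^sup>2 * (norm_sq ?H / \<bar>1 / h\<bar>) = norm_sq ?H / (2 * pi) / (2 * pi * h)"
    using h by (simp add: field_simps power2_eq_square)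
  also have "\<dots> \<le> norm_sq ?g / (2 * pi * h)"
    using H(2) h by (intro divide_right_mono) (auto simp: field_simps)
  also have "\<dots> \<le> sqrt 2 * exp (- d\<^sup>2 / (2 * h))"
    using g(2) h by (simp add: field_simps)
  finally show "norm_sq (spec_proj_p h B (coh h x0 p0)) \<le> sqrt 2 * exp (- d\<^sup>2 / (2 * h))" .
qed

text \<open>The L1 norm of the cut-off Fourier transform bounds the inverse transform. This supplies
  the sup bound required by \<open>expval_Q_op\<close>.\<close>

lemma spec_proj_coh_bounded:
  assumes h: "h > 0" and B: "B \<in> sets borel"
  obtains C where "\<And>x. cmod (spec_proj_p h B (coh h x0 p0) x) \<le> C"
proof
  fix x
  let ?g = "\<lambda>p. indicator B p * coh_hat h x0 p0 p"
  have "cmod (LINT p|lborel. ?g p * exp (\<i> * complex_of_real (p * (x / h)))) \<le> (LINT p|lborel. cmod (?g p))"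
    by (rule order_trans[OF integral_norm_bound]) (simp add: norm_mult)
  then show "cmod (spec_proj_p h B (coh h x0 p0) x) \<le> 1 / (2 * pi * h) * (LINT p|lborel. cmod (?g p))"
    unfolding spec_proj_coh_eq[OF h] norm_mult[of "complex_of_real _"] norm_of_real
    using h by (simp add: divide_right_mono)
qed

text \<open>The two cutoffs add up to the full inverse transform, and Fourier inversion is here one
  explicit Gaussian integral.\<close>

lemma spec_proj_coh_add_compl:
  assumes h: "h > 0" and B[measurable]: "B \<in> sets borel"
  shows "spec_proj_p h B (coh h x0 p0) x + spec_proj_p h (- B) (coh h x0 p0) x = coh h x0 p0 x"
proof -
  let ?e = "\<lambda>p. exp (\<i> * complex_of_real (p * (x / h)))"
  let ?g = "\<lambda>B p. indicator B p * coh_hat h x0 p0 p * ?e p"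
  have int: "integrable lborel (?g B')" if [measurable]: "B' \<in> sets borel" for B'
    by (rule Bochner_Integration.integrable_bound[OF integrable_coh_hat[OF h that, of x0 p0]])
       (auto simp: norm_mult)
  have cB: "- B \<in> sets borel" by measurable
  have "(LINT p|lborel. ?g B p) + (LINT p|lborel. ?g (- B) p) = (LINT p|lborel. ?g B p + ?g (- B) p)"
    by (rule Bochner_Integration.integral_add[symmetric]) (intro int B cB)+
  also have "\<dots> = (LINT p|lborel. coh_hat h x0 p0 p * ?e p)"
    by (rule Bochner_Integration.integral_cong) (auto simp: indicator_def)
  also have "\<dots> = complex_of_real (2 * pi * h) * coh h x0 p0 x"
  proof -
    let ?K = "complex_of_real ((pi * h) powr (-1/4) * sqrt (2 * pi * h)) * exp (\<i> * complex_of_real (p0 * x0 / (2 * h)))"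
    have eq: "coh_hat h x0 p0 p * ?e p = ?K * (complex_of_real (exp (- (p - p0)\<^sup>2 / (2 * h))) * exp (\<i> * complex_of_real ((x - x0) / h * p)))" for p
    proof -
      have "exp (\<i> * complex_of_real ((p0 / 2 - p) * x0 / h)) * ?e p
         = exp (\<i> * complex_of_real (p0 * x0 / (2 * h))) * exp (\<i> * complex_of_real ((x - x0) / h * p))"
        by (simp add: exp_add[symmetric] algebra_simps diff_divide_distrib)
      then show ?thesis by (simp add: coh_hat_def mult_ac)
    qed
    have "(LINT p|lborel. coh_hat h x0 p0 p * ?e p) =
       ?K * (complex_of_real (sqrt (2 * pi * h) * exp (- (((x - x0) / h)\<^sup>2 * h / 2))) * exp (\<i> * complex_of_real ((x - x0) / h * p0)))"
      unfolding eq
      by (intro has_bochner_integral_integral_eq has_bochner_integral_mult_right has_bochner_integral_gaussian_fourier h)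
    also have "((x - x0) / h)\<^sup>2 * h / 2 = (x - x0)\<^sup>2 / (2 * h)"
      using h by (simp add: power_divide power2_eq_square[of h])
    also have "?K * (complex_of_real (sqrt (2 * pi * h) * exp (- ((x - x0)\<^sup>2 / (2 * h)))) * exp (\<i> * complex_of_real ((x - x0) / h * p0)))
      = complex_of_real (sqrt (2 * pi * h) * sqrt (2 * pi * h)) * (complex_of_real ((pi * h) powr (-1/4) * exp (- ((x - x0)\<^sup>2 / (2 * h)))) *
        (exp (\<i> * complex_of_real (p0 * x0 / (2 * h))) * exp (\<i> * complex_of_real ((x - x0) / h * p0))))"
      by (simp only: of_real_mult mult_ac)
    also have "exp (\<i> * complex_of_real (p0 * x0 / (2 * h))) * exp (\<i> * complex_of_real ((x - x0) / h * p0))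
      = exp (\<i> * complex_of_real (p0 * x / h - p0 * x0 / (2 * h)))"
    proof -
      have "p0 * x0 / (2 * h) + (x - x0) / h * p0 = p0 * x / h - p0 * x0 / (2 * h)"
        using h by (simp add: field_simps)
      then show ?thesis by (simp only: exp_add[symmetric] distrib_left[symmetric] of_real_add[symmetric])
    qed
    also have "sqrt (2 * pi * h) * sqrt (2 * pi * h) = 2 * pi * h"
      using h by simp
    finally show ?thesis by (simp add: coh_def)
  qed
  finally have "(LINT p|lborel. ?g B p) + (LINT p|lborel. ?g (- B) p) = complex_of_real (2 * pi * h) * coh h x0 p0 x" .
  then show ?thesis
    unfolding spec_proj_coh_eq[OF h] distrib_left[symmetric] using h by simp
qed

section \<open>The baker operator on coherent states\<close>

lemma frac_sets [measurable]:
  "{x::real. frac x < 1/2} \<in> sets borel" "{x::real. 1/2 \<le> frac x} \<in> sets borel"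
  "{p::real. frac (p / 2) < 1/2} \<in> sets borel" "{p::real. 1/2 \<le> frac (p / 2)} \<in> sets borel"
  unfolding frac_def by measurable

lemma Compl_frac: "- {p::real. frac (p / 2) < 1/2} = {p. 1/2 \<le> frac (p / 2)}"
  by auto

lemma E_add_O_coh:
  assumes "h > 0"
  shows "E_p h (coh h x0 p0) x + O_p h (coh h x0 p0) x = coh h x0 p0 x"
  using spec_proj_coh_add_compl[OF assms frac_sets(3), of x0 p0 x] unfolding E_p_def O_p_def Compl_frac .

definition momentum_split_coh :: "real \<Rightarrow> real \<Rightarrow> real \<Rightarrow> wavefn" where
  "momentum_split_coh h x0 p0 = (\<lambda>u. E_p h (coh h x0 p0) u + Y_op (-1/2) (O_p h (coh h x0 p0)) u)"

text \<open>Write E, O for the projections, Y for Y^(-1/2) and phi for the state. Since E phi + O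
  phi = phi, the error is - (O phi - Y O phi) in the first case and E phi - Y E phi in the second:
  up to the sign \<sigma>, a small projection \<open>D\<close> minus its translate. Two terms of
  equal norm give the factor 4.\<close>

lemma momentum_split_coh_approx:
  assumes h: "h > 0" and d: "d > 0"
    and s: "s = 0 \<and> (\<forall>p. 1/2 \<le> frac (p / 2) \<longrightarrow> d \<le> \<bar>p - p0\<bar>) \<or>
            s = -1/2 \<and> (\<forall>p. frac (p / 2) < 1/2 \<longrightarrow> d \<le> \<bar>p - p0\<bar>)"
  shows "sq_integrable (\<lambda>u. momentum_split_coh h x0 p0 u - coh h x0 p0 (u + s))"
    "norm_sq (\<lambda>u. momentum_split_coh h x0 p0 u - coh h x0 p0 (u + s)) \<le> 4 * (sqrt 2 * exp (- d\<^sup>2 / (2 * h)))"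
proof -
  let ?t = "sqrt 2 * exp (- d\<^sup>2 / (2 * h))"
  obtain D \<sigma> where D: "sq_integrable D" "norm_sq D \<le> ?t" and \<sigma>: "cmod \<sigma> = 1"
    and eq: "\<And>u. momentum_split_coh h x0 p0 u - coh h x0 p0 (u + s) = \<sigma> * D u + (- \<sigma>) * D (-1/2 + 1 * u)"
    using s
  proof (elim disjE conjE)
    assume "s = 0" and far: "\<forall>p. 1/2 \<le> frac (p / 2) \<longrightarrow> d \<le> \<bar>p - p0\<bar>"
    show thesis
    proof (rule that[of "O_p h (coh h x0 p0)" "-1"])
      show "sq_integrable (O_p h (coh h x0 p0))" "norm_sq (O_p h (coh h x0 p0)) \<le> ?t"
        unfolding O_p_def using norm_sq_spec_proj_coh[OF h frac_sets(4), of d p0 x0] d far by auto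
      show "momentum_split_coh h x0 p0 u - coh h x0 p0 (u + s) =
        -1 * O_p h (coh h x0 p0) u + (- (- 1)) * O_p h (coh h x0 p0) (-1/2 + 1 * u)" for u
        using E_add_O_coh[OF h, of x0 p0 u] \<open>s = 0\<close>
        by (simp add: momentum_split_coh_def Y_op_def algebra_simps)
    qed simp
  next
    assume "s = -1/2" and far: "\<forall>p. frac (p / 2) < 1/2 \<longrightarrow> d \<le> \<bar>p - p0\<bar>"
    show thesis
    proof (rule that[of "E_p h (coh h x0 p0)" 1])
      show "sq_integrable (E_p h (coh h x0 p0))" "norm_sq (E_p h (coh h x0 p0)) \<le> ?t"
        unfolding E_p_def using norm_sq_spec_proj_coh[OF h frac_sets(3), of d p0 x0] d far by auto
      show "momentum_split_coh h x0 p0 u - coh h x0 p0 (u + s) =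
        1 * E_p h (coh h x0 p0) u + (- 1) * E_p h (coh h x0 p0) (-1/2 + 1 * u)" for u
        using E_add_O_coh[OF h, of x0 p0 "u - 1/2"] \<open>s = -1/2\<close>
        by (simp add: momentum_split_coh_def Y_op_def algebra_simps)
    qed simp
  qed
  note A = norm_sq_cmult[OF D(1), of \<sigma>]
  have one: "(1::real) \<noteq> 0" by simp
  note S = norm_sq_affine[OF D(1) one, of "-1/2"]
  note B = norm_sq_cmult[OF S(1), of "- \<sigma>"]
  note AB = norm_sq_add[OF A(1) B(1)]
  show "sq_integrable (\<lambda>u. momentum_split_coh h x0 p0 u - coh h x0 p0 (u + s))"
    unfolding eq by (rule AB(1))
  have "norm_sq (\<lambda>u. momentum_split_coh h x0 p0 u - coh h x0 p0 (u + s)) \<le> 2 * norm_sq D + 2 * norm_sq D"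
    unfolding eq using AB(2) unfolding A(2) B(2) S(2) using \<sigma> by simp
  also have "\<dots> \<le> 4 * ?t" using D(2) by simp
  finally show "norm_sq (\<lambda>u. momentum_split_coh h x0 p0 u - coh h x0 p0 (u + s)) \<le> 4 * ?t" .
qed

text \<open>Y^s moves the centre to x0 - s, X^k adds k to the momentum, and S doubles position and
  halves momentum, so the state is centred at (2 (x0 - s), (p0 + k) / 2).\<close>

definition shifted_coh :: "real \<Rightarrow> real \<Rightarrow> real \<Rightarrow> real \<Rightarrow> real \<Rightarrow> wavefn" where
  "shifted_coh h s k x0 p0 = S_op (X_op h k (Y_op s (coh h x0 p0)))"

lemma norm_sq_S_op:
  assumes f: "sq_integrable f"
  shows "sq_integrable (S_op f)" "norm_sq (S_op f) = norm_sq f"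
proof -
  have half: "(1/2::real) \<noteq> 0" by simp
  note S = norm_sq_affine[OF f half, of 0]
  have eq: "S_op f = (\<lambda>x. complex_of_real (1 / sqrt 2) * f (0 + 1/2 * x))"
    by (simp add: S_op_def)
  show "sq_integrable (S_op f)" unfolding eq by (rule norm_sq_cmult(1)[OF S(1)])
  show "norm_sq (S_op f) = norm_sq f"
    unfolding eq norm_sq_cmult(2)[OF S(1)] S(2) by (simp add: norm_divide power_divide)
qed

lemma norm_sq_shifted_coh:
  assumes h: "h > 0"
  shows "sq_integrable (shifted_coh h s k x0 p0)" "norm_sq (shifted_coh h s k x0 p0) = 1"
proof -
  have one: "(1::real) \<noteq> 0" by simp
  note Y = norm_sq_affine[OF norm_sq_coh(1)[OF h, of x0 p0] one, of s]
  let ?f = "X_op h k (Y_op s (coh h x0 p0))"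
  have [measurable]: "?f \<in> borel_measurable borel"
    unfolding X_op_def Y_op_def by measurable
  have "cmod (?f x) = cmod (coh h x0 p0 (s + 1 * x))" for x
    by (simp add: X_op_def Y_op_def norm_mult add.commute)
  then have f: "sq_integrable ?f" "norm_sq ?f = 1"
    using Y norm_sq_coh(2)[OF h, of x0 p0] by (auto simp: sq_integrable_def norm_sq_def)
  show "sq_integrable (shifted_coh h s k x0 p0)" "norm_sq (shifted_coh h s k x0 p0) = 1"
    unfolding shifted_coh_def using norm_sq_S_op[OF f(1)] f(2) by auto
qed

text \<open>The case s = 0 is p0 in the E region, s = -1/2 the O region; k = 0 and k = -1 mean that the
  translated centre x0 - s lies in the L region and in the R region. Each hypothesis keeps the
  centre at distance d from the region that contributes only an error.\<close>

lemma F_op_approx: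
  assumes h: "h > 0" and d: "d > 0"
    and s: "s = 0 \<and> (\<forall>p. 1/2 \<le> frac (p / 2) \<longrightarrow> d \<le> \<bar>p - p0\<bar>) \<or>
            s = -1/2 \<and> (\<forall>p. frac (p / 2) < 1/2 \<longrightarrow> d \<le> \<bar>p - p0\<bar>)"
    and k: "k = 0 \<and> (\<forall>x. 1/2 \<le> frac x \<longrightarrow> d \<le> \<bar>x + s - x0\<bar>) \<or>
            k = -1 \<and> (\<forall>x. frac x < 1/2 \<longrightarrow> d \<le> \<bar>x + s - x0\<bar>)"
  shows "sq_integrable (\<lambda>x. F_op h (coh h x0 p0) x - shifted_coh h s k x0 p0 x)"
    "norm_sq (\<lambda>x. F_op h (coh h x0 p0) x - shifted_coh h s k x0 p0 x) \<le> 16 * (sqrt 2 * exp (- d\<^sup>2 / (2 * h)))"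
proof -
  let ?t = "sqrt 2 * exp (- d\<^sup>2 / (2 * h))"
  let ?\<phi> = "coh h x0 p0"
  let ?err = "\<lambda>u. momentum_split_coh h x0 p0 u - ?\<phi> (u + s)"
  note E = momentum_split_coh_approx[OF h d s, of x0]
  define e where "e = (\<lambda>k u. exp (\<i> * complex_of_real (k * u / h)))"
  have [measurable]: "e k \<in> borel_measurable borel" for k unfolding e_def by measurable
  have cmod_e: "cmod (e k u) = 1" for k u by (simp add: e_def)
  \<comment> \<open>L + X^(-1) R is multiplication by this unimodular function, so it does not
    enlarge the momentum error.\<close>
  define M where "M = (\<lambda>u. indicator {x. frac x < 1/2} u + indicator {x. 1/2 \<le> frac x} u * e (-1) u)"
  have [measurable]: "M \<in> borel_measurable borel" unfolding M_def by measurable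
  have cmod_M: "cmod (M u) = 1" for u by (auto simp: M_def indicator_def cmod_e)
  \<comment> \<open>The set where \<open>M\<close> may differ from the phase of X^k. Its translate
    \<open>Bad'\<close> describes it in the argument u + s of the coherent state.\<close>
  define Bad where "Bad = (if k = 0 then {x::real. 1/2 \<le> frac x} else {x. frac x < 1/2})"
  have [measurable]: "Bad \<in> sets borel"
    by (cases "k = 0") (simp_all only: Bad_def if_True if_False frac_sets simp_thms)
  define Bad' where "Bad' = {v. v - s \<in> Bad}"
  have Bad': "Bad' \<in> sets borel" unfolding Bad'_def by measurable
  have far: "d \<le> \<bar>v - x0\<bar>" if "v \<in> Bad'" for v
    using k that by (auto simp: Bad'_def Bad_def split: if_splits dest: spec[of _ "v - s"])
  note I = norm_sq_coh_indicator[OF h Bad' less_imp_le[OF d] far, of p0]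
  have one: "(1::real) \<noteq> 0" by simp
  note Is = norm_sq_affine[OF I(1) one, of s]
  note I2 = norm_sq_cmult[OF Is(1), of 2]
  have e0: "e 0 u = 1" for u by (simp add: e_def)
  have Me: "cmod ((M u - e k u) * ?\<phi> (u + s)) \<le> cmod (2 * (indicator Bad' (s + 1 * u) * ?\<phi> (s + 1 * u)))" for u
  proof (cases "u \<in> Bad")
    case True
    then have "s + 1 * u \<in> Bad'" by (simp add: Bad'_def)
    moreover have "cmod (M u - e k u) \<le> 2"
      using norm_triangle_ineq4[of "M u" "e k u"] by (simp add: cmod_M cmod_e)
    ultimately show ?thesis by (simp add: norm_mult add.commute mult_right_mono)
  next
    case False
    then have "M u = e k u" using k by (auto simp: M_def Bad_def e0 indicator_def)
    then show ?thesis by simp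
  qed
  have q2: "sq_integrable (\<lambda>u. (M u - e k u) * ?\<phi> (u + s))"
      "norm_sq (\<lambda>u. (M u - e k u) * ?\<phi> (u + s)) \<le> 4 * ?t"
  proof -
    show "sq_integrable (\<lambda>u. (M u - e k u) * ?\<phi> (u + s))"
      by (rule norm_sq_mono(1)[OF I2(1) _ Me]) measurable
    have "norm_sq (\<lambda>u. (M u - e k u) * ?\<phi> (u + s)) \<le> norm_sq (\<lambda>u. 2 * (indicator Bad' (s + 1 * u) * ?\<phi> (s + 1 * u)))"
      by (rule norm_sq_mono(2)[OF I2(1) _ Me]) measurable
    also have "\<dots> = (cmod 2)\<^sup>2 * norm_sq (\<lambda>u. indicator Bad' (s + 1 * u) * ?\<phi> (s + 1 * u))"
      by (rule I2(2))
    also have "norm_sq (\<lambda>u. indicator Bad' (s + 1 * u) * ?\<phi> (s + 1 * u)) = norm_sq (\<lambda>v. indicator Bad' v * ?\<phi> v) / \<bar>1\<bar>"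
      by (rule Is(2))
    also have "(cmod 2)\<^sup>2 * (norm_sq (\<lambda>v. indicator Bad' v * ?\<phi> v) / \<bar>1\<bar>) \<le> 4 * ?t"
      using I(2) by simp
    finally show "norm_sq (\<lambda>u. (M u - e k u) * ?\<phi> (u + s)) \<le> 4 * ?t" .
  qed
  note [measurable] = sq_integrable_measurable[OF E(1)]
  have le1: "cmod (M u * ?err u) \<le> cmod (?err u)" for u by (simp add: norm_mult cmod_M)
  have q1: "sq_integrable (\<lambda>u. M u * ?err u)" by (rule norm_sq_mono(1)[OF E(1) _ le1]) measurable
  have "norm_sq (\<lambda>u. M u * ?err u) \<le> norm_sq ?err" by (rule norm_sq_mono(2)[OF E(1) _ le1]) measurable
  with E(2) have q1': "norm_sq (\<lambda>u. M u * ?err u) \<le> 4 * ?t" by simp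
  note Q = norm_sq_add[OF q1 q2(1)]
  \<comment> \<open>Telescoping into the momentum error carried through \<open>M\<close> and the
    position error. Each is at most 4 ?t, the latter because |M - e k| <= 2, and
    \<open>norm_sq_add\<close> turns this into 16 ?t.\<close>
  let ?q = "\<lambda>u. M u * ?err u + (M u - e k u) * ?\<phi> (u + s)"
  have F: "F_op h ?\<phi> = S_op (\<lambda>u. M u * momentum_split_coh h x0 p0 u)"
    unfolding F_op_def Let_def momentum_split_coh_def[symmetric]
    by (intro arg_cong[where f = S_op] ext) (simp add: L_op_def R_op_def X_op_def M_def e_def algebra_simps)
  have eq: "(\<lambda>x. F_op h ?\<phi> x - shifted_coh h s k x0 p0 x) = S_op ?q"
    unfolding F shifted_coh_def S_op_def X_op_def Y_op_def e_def[symmetric]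
    by (auto simp: e_def algebra_simps)
  show "sq_integrable (\<lambda>x. F_op h ?\<phi> x - shifted_coh h s k x0 p0 x)"
    unfolding eq by (rule norm_sq_S_op(1)[OF Q(1)])
  show "norm_sq (\<lambda>x. F_op h ?\<phi> x - shifted_coh h s k x0 p0 x) \<le> 16 * ?t"
    unfolding eq norm_sq_S_op(2)[OF Q(1)] using Q(2) q1' q2(2) by simp
qed

lemma F_op_coh_bounded:
  assumes h: "h > 0"
  shows "\<exists>C. \<forall>x. cmod (F_op h (coh h x0 p0) x) \<le> C"
proof -
  obtain C1 where C1: "\<And>x. cmod (E_p h (coh h x0 p0) x) \<le> C1"
    unfolding E_p_def by (rule spec_proj_coh_bounded[OF h frac_sets(3), of x0 p0]) blast
  obtain C2 where C2: "\<And>x. cmod (O_p h (coh h x0 p0) x) \<le> C2"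
    unfolding O_p_def by (rule spec_proj_coh_bounded[OF h frac_sets(4), of x0 p0]) blast
  have G: "cmod (momentum_split_coh h x0 p0 u) \<le> C1 + C2" for u
    unfolding momentum_split_coh_def Y_op_def by (intro norm_triangle_mono C1 C2)
  have "cmod (F_op h (coh h x0 p0) x) \<le> 1 / sqrt 2 * (C1 + C2)" for x
    unfolding F_op_def Let_def momentum_split_coh_def[symmetric] S_op_def norm_mult
    by (intro mult_mono) (use G[of "x / 2"] in \<open>auto simp: L_op_def R_op_def X_op_def indicator_def norm_mult norm_divide intro: order_trans[OF norm_ge_zero]\<close>)
  then show ?thesis by blast
qed

section \<open>Limits of Weyl matrix elements\<close>

lemma tendsto_shifted_coh_weyl:
  "((\<lambda>h. expval (shifted_coh h s k x0 p0) (weyl h a b (shifted_coh h s k x0 p0)))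
     \<longlongrightarrow> exp (2 * pi * \<i> * complex_of_real (a * (2 * x0 - 2 * s) + b * ((p0 + k) / 2)))) (at_right 0)"
proof -
  \<comment> \<open>Undoing S doubles the frequency 2 pi a and halves the translation 2 pi h b,
    which gives \<open>c\<close> and h \<open>t\<close>.\<close>
  define c where "c = 4 * pi * real_of_int a"
  define t where "t = pi * real_of_int b"
  let ?J = "\<lambda>h. LINT u|lborel. cnj (coh h x0 p0 u) * (exp (\<i> * complex_of_real (c * u)) * coh h x0 p0 (u + h * t))"
  let ?w = "exp (\<i> * complex_of_real (k * t - c * s))"
  have main: "expval (shifted_coh h s k x0 p0) (weyl h a b (shifted_coh h s k x0 p0)) = ?w * ?J h" if h: "h > 0" for h
  proof -
    let ?f = "\<lambda>x. cnj (shifted_coh h s k x0 p0 x) * weyl h a b (shifted_coh h s k x0 p0) x"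
    let ?j = "\<lambda>u. cnj (coh h x0 p0 u) * (exp (\<i> * complex_of_real (c * u)) * coh h x0 p0 (u + h * t))"
    \<comment> \<open>The substitution x = 2 (v - s) undoes both S and Y^s. The factor 1/2 comes
      from S and cancels against the Jacobian 2; X^k and the shift by s leave only the constant
      phase \<open>?w\<close>.\<close>
    have pt: "?f (- 2 * s + 2 * v) = (1/2) * (?w * ?j v)" for v
    proof -
      have "cnj (exp (\<i> * complex_of_real (k * (v - s) / h))) *
          (exp (2 * pi * \<i> * complex_of_real (real_of_int a * (- 2 * s + 2 * v))) *
           exp (\<i> * complex_of_real (k * (v - s + h * t) / h))) = ?w * exp (\<i> * complex_of_real (c * v))"
      proof -
        have "- (k * (v - s) / h) + (2 * pi * (real_of_int a * (- 2 * s + 2 * v)) + k * (v - s + h * t) / h)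
            = (k * t - c * s) + c * v"
          using h by (simp add: c_def field_simps)
        then have "exp (\<i> * complex_of_real (- (k * (v - s) / h) + (2 * pi * (real_of_int a * (- 2 * s + 2 * v)) + k * (v - s + h * t) / h)))
            = exp (\<i> * complex_of_real ((k * t - c * s) + c * v))"
          by (simp only:)
        moreover have "cnj (exp (\<i> * complex_of_real y)) = exp (\<i> * complex_of_real (- y))" for y
          by (simp add: exp_cnj)
        moreover have "exp (2 * pi * \<i> * complex_of_real y) = exp (\<i> * complex_of_real (2 * pi * y))" for y
          by (simp add: mult_ac)
        ultimately show ?thesis
          by (simp only: of_real_add distrib_left exp_add)
      qed
      moreover have "cnj (complex_of_real (1 / sqrt 2)) * complex_of_real (1 / sqrt 2) = 1/2"
        by (simp flip: of_real_mult)
      moreover have "(- 2 * s + 2 * v) / 2 = v - s" "(- 2 * s + 2 * v + 2 * pi * h * real_of_int b) / 2 = v - s + h * t"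
        by (auto simp: t_def field_simps)
      moreover have "v - s + h * t + s = v + h * t" "v - s + s = v" by auto
      ultimately show ?thesis
        unfolding shifted_coh_def weyl_def S_op_def X_op_def Y_op_def complex_cnj_mult
        by (smt (verit) mult.assoc mult.commute mult.left_commute)
    qed
    have "expval (shifted_coh h s k x0 p0) (weyl h a b (shifted_coh h s k x0 p0)) = \<bar>2\<bar> *\<^sub>R (LINT v|lborel. ?f (- 2 * s + 2 * v))"
      unfolding expval_def by (rule lborel_integral_real_affine) simp
    also have "\<dots> = ?w * ?J h"
      unfolding pt integral_mult_right_zero by (simp add: scaleR_conv_of_real)
    finally show ?thesis .
  qed
  have "((\<lambda>h. ?w * ?J h) \<longlongrightarrow> ?w * exp (\<i> * complex_of_real (p0 * t + c * x0))) (at_right 0)"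
    by (intro tendsto_intros tendsto_coh_overlap)
  also have "?w * exp (\<i> * complex_of_real (p0 * t + c * x0)) = exp (2 * pi * \<i> * complex_of_real (a * (2 * x0 - 2 * s) + b * ((p0 + k) / 2)))"
  proof -
    have "k * t - c * s + (p0 * t + c * x0) = 2 * pi * (a * (2 * x0 - 2 * s) + b * ((p0 + k) / 2))"
      by (simp add: c_def t_def field_simps)
    moreover have "exp (2 * pi * \<i> * complex_of_real y) = exp (\<i> * complex_of_real (2 * pi * y))" for y
      by (simp add: mult_ac)
    ultimately show ?thesis
      by (simp only: exp_add[symmetric] distrib_left[symmetric] of_real_add[symmetric])
  qed
  finally show ?thesis
    by (rule Lim_transform_eventually)
       (use eventually_at_right_less[of "0::real"] in eventually_elim, simp add: main)
qed

lemma tendsto_coh_weyl: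
  "((\<lambda>h. expval (coh h x0 p0) (weyl h a b (coh h x0 p0)))
     \<longlongrightarrow> exp (2 * pi * \<i> * complex_of_real (a * x0 + b * p0))) (at_right 0)"
proof -
  have eq: "exp (2 * pi * \<i> * complex_of_real (real_of_int a * x)) = exp (\<i> * complex_of_real (2 * pi * a * x))" for x
    by (simp add: mult_ac)
  have eq2: "x + 2 * pi * h * real_of_int b = x + h * (2 * pi * b)" for x h
    by simp
  have eq3: "exp (\<i> * complex_of_real (p0 * (2 * pi * b) + 2 * pi * a * x0)) = exp (2 * pi * \<i> * complex_of_real (a * x0 + b * p0))"
    by (simp add: algebra_simps)
  show ?thesis
    unfolding expval_def weyl_def eq eq2
    using tendsto_coh_overlap[of x0 p0 "2 * pi * a" "2 * pi * b"] unfolding eq3 .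
qed

text \<open>The state is \<open>shifted_coh\<close>, of norm 1, plus an exponentially small
  remainder, so \<open>expval_weyl_perturb\<close> transfers the limit. The constant is 2 * 1 + 2 *
  (16 * sqrt 2), with the exponential bounded by 1; being free of \<open>h\<close>, it also provides
  the domination in Tannery's theorem.\<close>

lemma tendsto_F_op_weyl:
  assumes d: "d > 0"
    and s: "s = 0 \<and> (\<forall>p. 1/2 \<le> frac (p / 2) \<longrightarrow> d \<le> \<bar>p - p0\<bar>) \<or>
            s = -1/2 \<and> (\<forall>p. frac (p / 2) < 1/2 \<longrightarrow> d \<le> \<bar>p - p0\<bar>)"
    and k: "k = 0 \<and> (\<forall>x. 1/2 \<le> frac x \<longrightarrow> d \<le> \<bar>x + s - x0\<bar>) \<or>
            k = -1 \<and> (\<forall>x. frac x < 1/2 \<longrightarrow> d \<le> \<bar>x + s - x0\<bar>)"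
  shows "h > 0 \<Longrightarrow> sq_integrable (F_op h (coh h x0 p0))"
    and "h > 0 \<Longrightarrow> norm_sq (F_op h (coh h x0 p0)) \<le> 2 + 32 * sqrt 2"
    and "((\<lambda>h. expval (F_op h (coh h x0 p0)) (weyl h a b (F_op h (coh h x0 p0))))
     \<longlongrightarrow> exp (2 * pi * \<i> * complex_of_real (a * (2 * x0 - 2 * s) + b * ((p0 + k) / 2)))) (at_right 0)"
proof -
  let ?F = "\<lambda>h. F_op h (coh h x0 p0)"
  let ?\<psi> = "\<lambda>h. shifted_coh h s k x0 p0"
  let ?r = "\<lambda>h x. ?F h x - ?\<psi> h x"
  note r = F_op_approx[OF _ d s k]
  note \<psi> = norm_sq_shifted_coh[of _ s k x0 p0]
  have F: "?F h = (\<lambda>x. ?\<psi> h x + ?r h x)" for h by simp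
  show sq: "sq_integrable (?F h)" if "h > 0" for h
    using norm_sq_add(1)[OF \<psi>(1) r(1), OF that that] by simp
  show nb: "norm_sq (?F h) \<le> 2 + 32 * sqrt 2" if "h > 0" for h
  proof -
    have "exp (- d\<^sup>2 / (2 * h)) \<le> 1" using that by simp
    then have "16 * (sqrt 2 * exp (- d\<^sup>2 / (2 * h))) \<le> 16 * sqrt 2" by simp
    moreover have "norm_sq (?F h) \<le> 2 * norm_sq (?\<psi> h) + 2 * norm_sq (?r h)"
      using norm_sq_add(2)[OF \<psi>(1) r(1), OF that that] by simp
    ultimately show ?thesis using \<psi>(2)[OF that] r(2)[OF that] by linarith
  qed
  let ?m = "\<lambda>\<psi> h. expval (\<psi> h) (weyl h a b (\<psi> h))"
  let ?R = "\<lambda>h. sqrt (16 * (sqrt 2 * exp (- d\<^sup>2 / (2 * h)))) * (sqrt (2 + 32 * sqrt 2) + 1)"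
  have "cmod (?m ?F h - ?m ?\<psi> h) \<le> ?R h" if h: "h > 0" for h
  proof -
    have "cmod (?m ?F h - ?m ?\<psi> h) \<le> sqrt (norm_sq (?r h)) * (sqrt (norm_sq (?F h)) + sqrt (norm_sq (?\<psi> h)))"
      using expval_weyl_perturb[OF \<psi>(1)[OF h] r(1)[OF h], of h a b] by simp
    also have "\<dots> \<le> ?R h"
      using r(2)[OF h] nb[OF h] \<psi>(2)[OF h] by (intro mult_mono add_mono) auto
    finally show ?thesis .
  qed
  then have bd: "eventually (\<lambda>h. cmod (?m ?F h - ?m ?\<psi> h) \<le> ?R h) (at_right 0)"
    using eventually_at_right_less[of "0::real"] by (auto elim: eventually_mono)
  have "(?R \<longlongrightarrow> sqrt (16 * (sqrt 2 * 0)) * (sqrt (2 + 32 * sqrt 2) + 1)) (at_right 0)"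
    by (intro tendsto_intros tendsto_gaussian_tail d)
  then have "(?R \<longlongrightarrow> 0) (at_right 0)" by simp
  with bd have "((\<lambda>h. ?m ?F h - ?m ?\<psi> h) \<longlongrightarrow> 0) (at_right 0)"
    by (rule Lim_null_comparison)
  from tendsto_add[OF this tendsto_shifted_coh_weyl[of s k x0 p0 a b]]
  show "(?m ?F \<longlongrightarrow> exp (2 * pi * \<i> * complex_of_real (a * (2 * x0 - 2 * s) + b * ((p0 + k) / 2)))) (at_right 0)"
    by simp
qed

section \<open>Generic phase-space points and the baker map modulo the lattice\<close>

lemma frac_half_locally_constant:
  fixes t :: real
  assumes "2 * t \<notin> \<int>"
  obtains d where "d > 0" "\<And>t'. \<bar>t' - t\<bar> < d \<Longrightarrow> frac t' < 1/2 \<longleftrightarrow> frac t < 1/2"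
proof
  \<comment> \<open>The distance from \<open>t\<close> to the nearest half-integer, the only places
    where the condition can change.\<close>
  let ?d = "min (frac t) (min \<bar>frac t - 1/2\<bar> (1 - frac t))"
  have ni: "frac t \<noteq> 0" using assms by (auto simp: frac_eq_0_iff)
  have nh: "frac t \<noteq> 1/2"
  proof
    assume "frac t = 1/2"
    then have "2 * t = of_int (2 * \<lfloor>t\<rfloor> + 1)" by (simp add: frac_def)
    with assms show False by (metis Ints_of_int)
  qed
  have f: "0 \<le> frac t" "frac t < 1" by (auto simp: frac_lt_1)
  show "?d > 0" using ni nh f by auto
  fix t' assume t': "\<bar>t' - t\<bar> < ?d"
  have "\<lfloor>t'\<rfloor> = \<lfloor>t\<rfloor>"
    using t' by (intro floor_unique) (auto simp: frac_def)
  then have "frac t' = frac t + (t' - t)" by (simp add: frac_def)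
  then show "frac t' < 1/2 \<longleftrightarrow> frac t < 1/2" using t' by auto
qed

text \<open>The exceptional set is the union of the countably many lines x = n / 2 and p = n
  bounding the strips. It is null for the completed measure, hence for
  \<open>lborel\<close>.\<close>

lemma AE_half_integers:
  "AE z in (lborel :: (real \<times> real) measure). 2 * fst z \<notin> \<int> \<and> snd z \<notin> \<int>"
proof -
  have "negligible {z::real \<times> real. z \<bullet> (1, 0) = c}" "negligible {z::real \<times> real. z \<bullet> (0, 1) = c}" for c
    by (rule negligible_standard_hyperplane; simp add: Basis_prod_def)+
  then have "negligible ((\<Union>n::int. {z::real \<times> real. z \<bullet> (1, 0) = real_of_int n / 2}) \<union> (\<Union>n::int. {z. z \<bullet> (0, 1) = real_of_int n}))"
    by (intro negligible_Un negligible_countable_Union countable_image) (auto simp del: eq_divide_eq_numeral1)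
  then have "(\<Union>n::int. {z::real \<times> real. z \<bullet> (1, 0) = real_of_int n / 2}) \<union> (\<Union>n::int. {z. z \<bullet> (0, 1) = real_of_int n}) \<in> null_sets lebesgue"
    by (simp add: negligible_iff_null_sets)
  then have "AE z in (lebesgue :: (real \<times> real) measure). 2 * fst z \<notin> \<int> \<and> snd z \<notin> \<int>"
    by (rule AE_I') (auto simp: Ints_def inner_prod_def field_simps)
  then show ?thesis by (simp add: AE_completion_iff)
qed

lemma exp_two_pi_int_eq:
  assumes "x - y = real_of_int n"
  shows "exp (2 * pi * \<i> * complex_of_real x) = exp (2 * pi * \<i> * complex_of_real y)"
proof -
  have "2 * pi * \<i> * complex_of_real x = 2 * pi * \<i> * complex_of_real y + 2 * pi * \<i> * complex_of_real (x - y)"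
    by (simp add: algebra_simps)
  then show ?thesis unfolding exp_eq assms by (intro exI[of _ n]) simp
qed

text \<open>The image point (2 (x0 - s), (p0 + k) / 2) agrees with the baker map only modulo the integer
  lattice, which torus observables do not see.\<close>

lemma baker_limit_parameters:
  assumes x0: "2 * x0 \<notin> \<int>" and p0: "p0 \<notin> \<int>"
  obtains d s k m n where "d > 0"
    "s = 0 \<and> (\<forall>p. 1/2 \<le> frac (p / 2) \<longrightarrow> d \<le> \<bar>p - p0\<bar>) \<or>
     s = -1/2 \<and> (\<forall>p. frac (p / 2) < 1/2 \<longrightarrow> d \<le> \<bar>p - p0\<bar>)"
    "k = 0 \<and> (\<forall>x. 1/2 \<le> frac x \<longrightarrow> d \<le> \<bar>x + s - x0\<bar>) \<or>
     k = -1 \<and> (\<forall>x. frac x < 1/2 \<longrightarrow> d \<le> \<bar>x + s - x0\<bar>)"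
    "2 * x0 - 2 * s - fst (baker (x0, p0)) = real_of_int m"
    "(p0 + k) / 2 - snd (baker (x0, p0)) = real_of_int n"
proof -
  from p0 have "2 * (p0 / 2) \<notin> \<int>" by simp
  then obtain d1 where d1: "d1 > 0" "\<And>t. \<bar>t - p0 / 2\<bar> < d1 \<Longrightarrow> frac t < 1/2 \<longleftrightarrow> frac (p0 / 2) < 1/2"
    by (rule frac_half_locally_constant) blast
  define s :: real where "s = (if frac (p0 / 2) < 1/2 then 0 else -1/2)"
  have "2 * (x0 - s) \<notin> \<int>"
  proof
    assume *: "2 * (x0 - s) \<in> \<int>"
    have "2 * s \<in> \<int>" by (simp add: s_def)
    from Ints_add[OF * this] x0 show False by simp
  qed
  then obtain d2 where d2: "d2 > 0" "\<And>t. \<bar>t - (x0 - s)\<bar> < d2 \<Longrightarrow> frac t < 1/2 \<longleftrightarrow> frac (x0 - s) < 1/2"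
    by (rule frac_half_locally_constant) blast
  define k :: real where "k = (if frac (x0 - s) < 1/2 then 0 else -1)"
  \<comment> \<open>\<open>d1\<close> is a distance in the variable p / 2, hence the
    doubling.\<close>
  define d where "d = min (2 * d1) d2"
  have P: "d \<le> \<bar>p - p0\<bar>" if "frac (p / 2) < 1/2 \<longleftrightarrow> \<not> frac (p0 / 2) < 1/2" for p
  proof (rule ccontr)
    assume "\<not> d \<le> \<bar>p - p0\<bar>"
    then have "\<bar>p / 2 - p0 / 2\<bar> < d1" by (simp add: d_def abs_if split: if_splits)
    from d1(2)[OF this] that show False by blast
  qed
  have X: "d \<le> \<bar>x + s - x0\<bar>" if "frac x < 1/2 \<longleftrightarrow> \<not> frac (x0 - s) < 1/2" for x
  proof (rule ccontr)
    assume "\<not> d \<le> \<bar>x + s - x0\<bar>"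
    then have "\<bar>x - (x0 - s)\<bar> < d2" by (simp add: d_def algebra_simps)
    from d2(2)[OF this] that show False by blast
  qed
  \<comment> \<open>For p0 in the O region the centre has moved to x0 + 1/2 before L and R act, and
    a half shift exchanges their strips. This is why the momentum jump in \<open>baker\<close>
    occurs for x0 in the R strip when p0 is in the E region, but in the L strip when it is in the O
    region.\<close>
  have half: "frac (x0 + 1/2) < 1/2 \<longleftrightarrow> \<not> frac x0 < 1/2"
  proof -
    have "frac (1/2 :: real) = 1/2" by (rule frac_unique_iff[THEN iffD2]) simp
    moreover have "\<not> frac x0 < 0" by (simp add: not_less)
    ultimately show ?thesis
      using frac_add[of x0 "1/2"] frac_lt_1[of x0] by auto
  qed
  have m: "\<exists>m. 2 * x0 - 2 * s - fst (baker (x0, p0)) = real_of_int m"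
  proof -
    \<comment> \<open>The value is 1 exactly when x0 lies in the R strip.\<close>
    have "2 * x0 - 2 * s - fst (baker (x0, p0)) \<in> {0, 1}"
      using half by (auto simp: baker_def s_def Let_def)
    then show ?thesis by (metis insert_iff singletonD of_int_0 of_int_1)
  qed
  have n: "\<exists>n. (p0 + k) / 2 - snd (baker (x0, p0)) = real_of_int n"
  proof -
    \<comment> \<open>The value equals \<open>k\<close>: X^(-1) and halving give p0 / 2 - 1/2, where
      \<open>baker\<close> has p0 / 2 + 1/2.\<close>
    have "(p0 + k) / 2 - snd (baker (x0, p0)) \<in> {0, -1}"
      using half by (auto simp: baker_def s_def k_def Let_def field_simps)
    then show ?thesis by (metis insert_iff singletonD of_int_0 of_int_1 of_int_minus)
  qed
  from m n obtain m n where mn: "2 * x0 - 2 * s - fst (baker (x0, p0)) = real_of_int m"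
    "(p0 + k) / 2 - snd (baker (x0, p0)) = real_of_int n" by blast
  show thesis
  proof (rule that[OF _ _ _ mn])
    show "d > 0" using d1 d2 by (simp add: d_def)
    show "s = 0 \<and> (\<forall>p. 1/2 \<le> frac (p / 2) \<longrightarrow> d \<le> \<bar>p - p0\<bar>) \<or>
      s = -1/2 \<and> (\<forall>p. frac (p / 2) < 1/2 \<longrightarrow> d \<le> \<bar>p - p0\<bar>)"
      using P by (auto simp: s_def)
    show "k = 0 \<and> (\<forall>x. 1/2 \<le> frac x \<longrightarrow> d \<le> \<bar>x + s - x0\<bar>) \<or>
      k = -1 \<and> (\<forall>x. frac x < 1/2 \<longrightarrow> d \<le> \<bar>x + s - x0\<bar>)"
      using X by (auto simp: k_def)
  qed
qed

theorem theorem4: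
  fixes A :: "int \<times> int \<Rightarrow> complex"
  assumes "(\<lambda>ab. norm (A ab)) summable_on UNIV"
  shows "AE z in (lborel :: (real \<times> real) measure).
     ((\<lambda>hbar. expval (F_op hbar (coh hbar (fst z) (snd z)))
                      (Q_op hbar A (F_op hbar (coh hbar (fst z) (snd z))))
             - expval (coh hbar (fst (baker z)) (snd (baker z)))
                      (Q_op hbar A (coh hbar (fst (baker z)) (snd (baker z)))))
       \<longlongrightarrow> 0) (at_right 0)"
  using AE_half_integers
proof eventually_elim
  case (elim z)
  obtain x0 p0 where z: "z = (x0, p0)" by fastforce
  have "2 * x0 \<notin> \<int>" "p0 \<notin> \<int>" using elim by (auto simp: z)
  then obtain d s k m n where d: "d > 0"
    and s: "s = 0 \<and> (\<forall>p. 1/2 \<le> frac (p / 2) \<longrightarrow> d \<le> \<bar>p - p0\<bar>) \<or>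
     s = -1/2 \<and> (\<forall>p. frac (p / 2) < 1/2 \<longrightarrow> d \<le> \<bar>p - p0\<bar>)"
    and k: "k = 0 \<and> (\<forall>x. 1/2 \<le> frac x \<longrightarrow> d \<le> \<bar>x + s - x0\<bar>) \<or>
     k = -1 \<and> (\<forall>x. frac x < 1/2 \<longrightarrow> d \<le> \<bar>x + s - x0\<bar>)"
    and m: "2 * x0 - 2 * s - fst (baker z) = real_of_int m"
    and n: "(p0 + k) / 2 - snd (baker z) = real_of_int n"
    unfolding z by (rule baker_limit_parameters)
  define e :: "nat \<Rightarrow> int \<times> int" where "e = from_nat_into UNIV"
  have e: "bij e"
    unfolding e_def by (rule bij_betw_from_nat_into) (auto simp: finite_prod)
  have "(\<lambda>n. norm (A (e n))) summable_on UNIV"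
    using summable_on_reindex_bij_betw[OF e, of "\<lambda>ab. norm (A ab)"] assms by simp
  then have A: "summable (\<lambda>n. norm (A (e n)))" by (rule summable_on_imp_summable)
  let ?w = "\<lambda>a b::int. exp (2 * pi * \<i> * complex_of_real (a * fst (baker z) + b * snd (baker z)))"
  \<comment> \<open>The common limit is the classical observable evaluated at
    \<open>baker z\<close>.\<close>
  let ?S = "\<Sum>n. A (e n) * ?w (fst (e n)) (snd (e n))"
  note F = tendsto_F_op_weyl[OF d s k]
  have w: "exp (2 * pi * \<i> * complex_of_real (a * (2 * x0 - 2 * s) + b * ((p0 + k) / 2))) = ?w a b" for a b :: int
  proof (rule exp_two_pi_int_eq)
    show "a * (2 * x0 - 2 * s) + b * ((p0 + k) / 2) - (a * fst (baker z) + b * snd (baker z)) = real_of_int (a * m + b * n)"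
      unfolding of_int_add of_int_mult m[symmetric] n[symmetric] by (simp add: algebra_simps)
  qed
  have "((\<lambda>h. expval (F_op h (coh h x0 p0)) (Q_op h A (F_op h (coh h x0 p0)))) \<longlongrightarrow> ?S) (at_right 0)"
  proof (rule tendsto_expval_Q_op[where C = "2 + 32 * sqrt 2", OF F(1) F_op_coh_bounded _ _ e A])
    show "eventually (\<lambda>h. norm_sq (F_op h (coh h x0 p0)) \<le> 2 + 32 * sqrt 2) (at_right 0)"
      using F(2) eventually_at_right_less[of "0::real"] by (auto elim: eventually_mono)
    show "((\<lambda>h. expval (F_op h (coh h x0 p0)) (weyl h a b (F_op h (coh h x0 p0)))) \<longlongrightarrow> ?w a b) (at_right 0)" for a b
      using F(3)[of a b] unfolding w .
  qed
  moreover have "((\<lambda>h. expval (coh h (fst (baker z)) (snd (baker z))) (Q_op h A (coh h (fst (baker z)) (snd (baker z))))) \<longlongrightarrow> ?S) (at_right 0)"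
  proof (rule tendsto_expval_Q_op[where C = 1, OF norm_sq_coh(1) _ _ tendsto_coh_weyl e A])
    show "\<exists>B. \<forall>x. cmod (coh h (fst (baker z)) (snd (baker z)) x) \<le> B" if "h > 0" for h
      using cmod_coh_le[OF that] by blast
    show "eventually (\<lambda>h. norm_sq (coh h (fst (baker z)) (snd (baker z))) \<le> 1) (at_right 0)"
      using eventually_at_right_less[of "0::real"] by eventually_elim (simp add: norm_sq_coh)
  qed
  ultimately show ?case
    using tendsto_diff unfolding z fst_conv snd_conv by fastforce
qed

end
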